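(* Let $0<c<1$. The dynamics on $\mathbb{R}^{|S|}\times\mathbb{R}^{|S|\times|A|}_{>0}$ $$\frac{dv_{s'}}{dt}=-\Big(v_{s'}-\frac1\alpha\sum_{s,a}K_{ass'}u_{sa}\Big),\ s'\in S,$$ $$\frac{du_{s\cdot}}{dt}=-\tilde u_s\big(\mathrm{diag}(\pi_{s\cdot})-c\,\pi_{s\cdot}\pi_{s\cdot}^{\mathsf T}\big)\Big(\log\frac{u_{s\cdot}}{\tilde u_s}-\frac1\tau\Big(r_{s\cdot}-\sum_{s'}K_{\cdot ss'}v_{s'}\Big)\Big),\ s\in S,$$ with $\pi_{sa}=u_{sa}/\tilde u_s$, converges globally to $(v^*,u^* )$, the unique saddle point of $\min_v\max_u E(v,u)$; i.e. $(v^*,u^* )$ is globally asymptotically stable.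
   Context: Finite MDP: state space $S$, action space $A$, transition probabilities $P_{ass'}$ (with $\sum_{s'}P_{ass'}=1$), rewards $r_{sa}\ge0$, discount $\gamma\in(0,1)$, regularization $\tau>0$, and $\alpha>0$. $K_{ass'}=\delta_{ss'}-\gamma P_{ass'}$, $\tilde u_s=\sum_a u_{sa}$. For fixed $s$, $u_{s\cdot},\pi_{s\cdot},r_{s\cdot}\in\mathbb{R}^{|A|}$ are the vectors indexed by $a$, $K_{\cdot ss'}\in\mathbb{R}^{|A|}$ has $a$-th entry $K_{ass'}$, logarithms and divisions of vectors are entrywise, and $\mathrm{diag}(x)$ is the diagonal matrix with diagonal $x$. $E(v,u)=\frac{\alpha}{2}\sum_s v_s^2+\sum_{s,a}u_{sa}(r_{sa}-\sum_{s'}K_{ass'}v_{s'})-\tau\sum_{s,a}u_{sa}\log(u_{sa}/\tilde u_s)$; this min-max problem has a unique saddle point $(v^*,u^* )$. *)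

theory Defs
  imports Complex_Main
begin

text \<open>States are elements of a finite type 's, actions of a finite type 'b.
  Value vectors v :: 's => real, occupancy variables u :: 's => 'b => real
  (u s a = u_{sa}); transition probabilities P a s s' = P_{ass'}.\<close>

definition Kmat :: "real \<Rightarrow> ('b \<Rightarrow> 's \<Rightarrow> 's \<Rightarrow> real) \<Rightarrow> 'b \<Rightarrow> 's \<Rightarrow> 's \<Rightarrow> real" where
  "Kmat \<gamma> P a s s' = (if s = s' then 1 else 0) - \<gamma> * P a s s'"

definition usum :: "('s \<Rightarrow> 'b::finite \<Rightarrow> real) \<Rightarrow> 's \<Rightarrow> real" where
  "usum u s = (\<Sum>a\<in>UNIV. u s a)"

definition pol :: "('s \<Rightarrow> 'b::finite \<Rightarrow> real) \<Rightarrow> 's \<Rightarrow> 'b \<Rightarrow> real" where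
  "pol u s a = u s a / usum u s"

definition Efun :: "real \<Rightarrow> real \<Rightarrow> real \<Rightarrow> ('b \<Rightarrow> 's \<Rightarrow> 's \<Rightarrow> real) \<Rightarrow> ('s \<Rightarrow> 'b \<Rightarrow> real)
     \<Rightarrow> ('s::finite \<Rightarrow> real) \<Rightarrow> ('s \<Rightarrow> 'b::finite \<Rightarrow> real) \<Rightarrow> real" where
  "Efun \<alpha> \<tau> \<gamma> P r v u =
     \<alpha> / 2 * (\<Sum>s\<in>UNIV. (v s)^2)
     + (\<Sum>s\<in>UNIV. \<Sum>a\<in>UNIV. u s a * (r s a - (\<Sum>s'\<in>UNIV. Kmat \<gamma> P a s s' * v s')))
     - \<tau> * (\<Sum>s\<in>UNIV. \<Sum>a\<in>UNIV. u s a * ln (u s a / usum u s))"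

definition posu :: "('s \<Rightarrow> 'b \<Rightarrow> real) \<Rightarrow> bool" where
  "posu u \<longleftrightarrow> (\<forall>s a. u s a > 0)"

definition saddle_point where
  "saddle_point \<alpha> \<tau> \<gamma> P r vs us \<longleftrightarrow> posu us \<and>
     (\<forall>v. Efun \<alpha> \<tau> \<gamma> P r vs us \<le> Efun \<alpha> \<tau> \<gamma> P r v us) \<and>
     (\<forall>u. posu u \<longrightarrow> Efun \<alpha> \<tau> \<gamma> P r vs u \<le> Efun \<alpha> \<tau> \<gamma> P r vs us)"

definition Fv :: "real \<Rightarrow> real \<Rightarrow> ('b \<Rightarrow> 's \<Rightarrow> 's \<Rightarrow> real)
     \<Rightarrow> ('s::finite \<Rightarrow> real) \<Rightarrow> ('s \<Rightarrow> 'b::finite \<Rightarrow> real) \<Rightarrow> 's \<Rightarrow> real" where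
  "Fv \<alpha> \<gamma> P v u s' =
     - (v s' - (1 / \<alpha>) * (\<Sum>s\<in>UNIV. \<Sum>a\<in>UNIV. Kmat \<gamma> P a s s' * u s a))"

definition gvec :: "real \<Rightarrow> real \<Rightarrow> ('b \<Rightarrow> 's \<Rightarrow> 's \<Rightarrow> real) \<Rightarrow> ('s \<Rightarrow> 'b \<Rightarrow> real)
     \<Rightarrow> ('s::finite \<Rightarrow> real) \<Rightarrow> ('s \<Rightarrow> 'b::finite \<Rightarrow> real) \<Rightarrow> 's \<Rightarrow> 'b \<Rightarrow> real" where
  "gvec \<tau> \<gamma> P r v u s a =
     ln (pol u s a) - (1 / \<tau>) * (r s a - (\<Sum>s'\<in>UNIV. Kmat \<gamma> P a s s' * v s'))"

text \<open>Right-hand side of the u-dynamics: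
  -ut_s (diag(pi_s) - c pi_s pi_s^T) g_s, component a.\<close>
definition Fu :: "real \<Rightarrow> real \<Rightarrow> real \<Rightarrow> ('b \<Rightarrow> 's \<Rightarrow> 's \<Rightarrow> real) \<Rightarrow> ('s \<Rightarrow> 'b \<Rightarrow> real)
     \<Rightarrow> ('s::finite \<Rightarrow> real) \<Rightarrow> ('s \<Rightarrow> 'b::finite \<Rightarrow> real) \<Rightarrow> 's \<Rightarrow> 'b \<Rightarrow> real" where
  "Fu c \<tau> \<gamma> P r v u s a =
     - usum u s * (pol u s a * gvec \<tau> \<gamma> P r v u s a
        - c * pol u s a * (\<Sum>b\<in>UNIV. pol u s b * gvec \<tau> \<gamma> P r v u s b))"

definition is_solution where
  "is_solution \<alpha> c \<tau> \<gamma> P r V U \<longleftrightarrow>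
     (\<forall>t\<ge>0. posu (U t)) \<and>
     (\<forall>t\<ge>0. \<forall>s'. ((\<lambda>x. V x s') has_real_derivative Fv \<alpha> \<gamma> P (V t) (U t) s') (at t within {0..})) \<and>
     (\<forall>t\<ge>0. \<forall>s a. ((\<lambda>x. U x s a) has_real_derivative Fu c \<tau> \<gamma> P r (V t) (U t) s a) (at t within {0..}))"

definition dist_vu :: "('s::finite \<Rightarrow> real) \<Rightarrow> ('s \<Rightarrow> 'b::finite \<Rightarrow> real)
     \<Rightarrow> ('s \<Rightarrow> real) \<Rightarrow> ('s \<Rightarrow> 'b \<Rightarrow> real) \<Rightarrow> real" where
  "dist_vu v u v' u' = sqrt ((\<Sum>s\<in>UNIV. (v s - v' s)^2) + (\<Sum>s\<in>UNIV. \<Sum>a\<in>UNIV. (u s a - u' s a)^2))"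

end

theory Submission
  (* Defs comes last so that its usum takes precedence over Old_Datatype.usum. *)
  imports "HOL-Analysis.Analysis" Defs
begin

text \<open>
  The matrix in the \<open>u\<close>-dynamics is the inverse Hessian of
  \<open>\<Phi>(u) = \<Sum> u\<^sub>s\<^sub>a ln u\<^sub>s\<^sub>a + c / (1 - c) \<Sum> w\<^sub>s ln w\<^sub>s\<close>, where \<open>w = usum u\<close>. Hence
  \<open>L = \<alpha>/2 |v - v\<^sup>*|\<^sup>2 + \<tau> D\<^sub>\<Phi>(u\<^sup>*, u)\<close>, with \<open>D\<^sub>\<Phi>\<close> the Bregman divergence, decreases at the rate
  \<open>\<alpha> |v - v\<^sup>*|\<^sup>2 + \<tau> \<Sum> (u - u\<^sup>*)(ln \<pi> - ln \<pi>\<^sup>*)\<close>: the bilinear coupling through \<open>K\<close> cancels. The sublevel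
  sets of \<open>L\<close> are compact in the positive orthant, which gives stability, and global existence by
  truncating the vector field outside a box. By Barbalat's lemma the rate tends to \<open>0\<close>, so
  \<open>v \<rightarrow> v\<^sup>*\<close> and \<open>\<pi> \<rightarrow> \<pi>\<^sup>*\<close>. Barbalat's lemma once more gives \<open>v' \<rightarrow> 0\<close>, which determines the limit
  of \<open>w\<close> because \<open>I - \<gamma> P\<^sub>\<pi>\<close> is invertible.
\<close>

section \<open>Global solutions and Barbalat's lemma\<close>

lemma integral_has_vector_derivative_atLeast:
  fixes g :: "real \<Rightarrow> 'a::banach"
  assumes "continuous_on {0..} g" "t \<ge> 0"
  shows "((\<lambda>u. integral {0..u} g) has_vector_derivative g t) (at t within {0..})"
proof -
  have "((\<lambda>u. integral {0..u} g) has_vector_derivative g t) (at t within {0..t+1})"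
    using assms by (intro integral_has_vector_derivative) (auto intro: continuous_on_subset)
  moreover have "at t within {0..} = at t within {0..t+1}"
    by (rule at_within_nhd[where S="{..<t+1}"]) auto
  ultimately show ?thesis by simp
qed

text \<open>Integrating the growth bound \<open>B * exp (l * s)\<close> costs a factor
  \<open>1 / l\<close>, and the weight removes the exponential. For the Picard operator this serves
  twice: applied to an affine growth bound it gives boundedness, applied to a Lipschitz bound it
  gives the contraction factor.\<close>

lemma norm_exp_weighted_integral_le:
  fixes g :: "real \<Rightarrow> 'a::banach"
  assumes "continuous_on {0..} g" "l > 0" "B \<ge> 0" "t \<ge> 0"
    and bound: "\<And>s. s \<ge> 0 \<Longrightarrow> norm (g s) \<le> B * exp (l * s)"
  shows "norm (exp (- (l * t)) *\<^sub>R integral {0..t} g) \<le> B / l"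
proof -
  have hi: "((\<lambda>s. B * exp (l * s)) has_integral (B / l * exp (l * t) - B / l * exp (l * 0))) {0..t}"
    using assms
    by (intro fundamental_theorem_of_calculus)
      (auto intro!: derivative_eq_intros simp: has_real_derivative_iff_has_vector_derivative[symmetric])
  have "norm (integral {0..t} g) \<le> integral {0..t} (\<lambda>s. B * exp (l * s))"
    using assms hi
    by (intro integral_norm_bound_integral integrable_continuous_real)
      (auto intro!: continuous_intros intro: continuous_on_subset)
  also have "\<dots> \<le> B / l * exp (l * t)"
    unfolding integral_unique[OF hi] using assms by simp
  finally have "exp (- (l * t)) * norm (integral {0..t} g) \<le> exp (- (l * t)) * (B / l * exp (l * t))"
    by (intro mult_left_mono) auto
  also have "\<dots> = B / l"
    by (simp add: exp_minus)
  finally show ?thesis by simp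
qed

text \<open>With the weight \<open>exp (- l t)\<close>, \<open>l > L\<close>, the Picard operator contracts on all of \<open>[0, \<infinity>)\<close> at
  once, so no continuation argument is needed.\<close>

lemma lipschitz_ode_global_solution:
  fixes F :: "'a::banach \<Rightarrow> 'a"
  assumes lip: "L-lipschitz_on UNIV F"
  obtains y where "y 0 = x0" "\<And>t. t \<ge> 0 \<Longrightarrow> (y has_vector_derivative F (y t)) (at t within {0..})"
proof -
  \<comment> \<open>The contraction factor will be \<open>L / l\<close>, which this choice keeps at
    most 1/2; the summand 1 keeps \<open>l\<close> positive when \<open>L = 0\<close>.\<close>
  define l where "l = 2 * L + 1"
  have L: "L \<ge> 0" and l: "l > 0"
    using lip lipschitz_on_nonneg[of L UNIV F] by (auto simp: l_def)
  have contF: "continuous_on S F" for S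
    using lipschitz_on_continuous_on[OF lip] by (rule continuous_on_subset) simp
  \<comment> \<open>The unknown \<open>h\<close> stands for the rescaled solution
    \<open>exp (- (l * t)) *\<^sub>R y t\<close>, which is bounded, so the fixed point can be sought
    in the complete space of bounded continuous functions. \<open>G h\<close> is then
    \<open>F\<close> along \<open>y\<close>.\<close>
  define G where "G = (\<lambda>(h :: real \<Rightarrow>\<^sub>C 'a) s. F (exp (l * s) *\<^sub>R apply_bcontfun h s))"
  have contG: "continuous_on S (G h)" for S h
    unfolding G_def by (intro continuous_intros continuous_on_compose2[OF contF]) auto
  have der: "((\<lambda>u. integral {0..u} (G h)) has_vector_derivative G h t) (at t within {0..})"
    if "t \<ge> 0" for h t
    using integral_has_vector_derivative_atLeast[OF contG that] .
  \<comment> \<open>Elements of the function space live on the whole real line, so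
    \<open>max 0 t\<close> extends the operator to negative times by its value at 0.\<close>
  define T where "T = (\<lambda>h t. exp (- (l * max 0 t)) *\<^sub>R (x0 + integral {0..max 0 t} (G h)))"
  have cont_int: "continuous_on {0..} (\<lambda>u. integral {0..u} (G h))" for h
    unfolding continuous_on_eq_continuous_within
    using der has_vector_derivative_continuous by fastforce
  have T_bcont: "T h \<in> bcontfun" for h
  proof (rule bcontfun_normI)
    show "continuous_on UNIV (T h)"
      unfolding T_def
      by (intro continuous_intros continuous_on_compose2[OF cont_int]) auto
  next
    fix t :: real
    define \<tau> where "\<tau> = max 0 t"
    have \<tau>: "\<tau> \<ge> 0" by (simp add: \<tau>_def)
    define B where "B = norm (F 0) + L * norm h"
    have B: "B \<ge> 0" using L by (simp add: B_def)
    have "norm (G h s) \<le> B * exp (l * s)" if "s \<ge> 0" for s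
    proof -
      have "norm (G h s) \<le> norm (F 0) + norm (F (exp (l * s) *\<^sub>R h s) - F 0)"
        unfolding G_def by (rule norm_triangle_sub)
      also have "\<dots> \<le> norm (F 0) + L * norm (exp (l * s) *\<^sub>R h s)"
        using lipschitz_on_normD[OF lip, of "exp (l * s) *\<^sub>R h s" 0] by simp
      also have "\<dots> \<le> norm (F 0) * exp (l * s) + L * (exp (l * s) * norm h)"
        using that l L norm_bounded[of h s]
        by (intro add_mono mult_left_mono mult_le_cancel_left1[THEN iffD2]) (auto intro!: mult_left_mono)
      finally show ?thesis by (simp add: B_def algebra_simps)
    qed
    then have "norm (exp (- (l * \<tau>)) *\<^sub>R integral {0..\<tau>} (G h)) \<le> B / l"
      using norm_exp_weighted_integral_le[OF contG l B \<tau>] by blast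
    moreover have "norm (exp (- (l * \<tau>)) *\<^sub>R x0) \<le> norm x0"
      using l \<tau> by (simp add: mult_left_le_one_le)
    ultimately show "norm (T h t) \<le> norm x0 + B / l"
      unfolding T_def \<tau>_def[symmetric] scaleR_add_right
      by (meson add_mono norm_triangle_le)
  qed
  define TT where "TT = (\<lambda>h. Bcontfun (T h))"
  have TT: "apply_bcontfun (TT h) = T h" for h
    unfolding TT_def using T_bcont by (rule Bcontfun_inverse)
  have "dist (TT h) (TT k) \<le> 1/2 * dist h k" for h k
  proof (rule dist_bound)
    fix t :: real
    define \<tau> where "\<tau> = max 0 t"
    have \<tau>: "\<tau> \<ge> 0" by (simp add: \<tau>_def)
    have "norm (G h s - G k s) \<le> (L * dist h k) * exp (l * s)" if "s \<ge> 0" for s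
    proof -
      have "norm (G h s - G k s) \<le> L * norm (exp (l * s) *\<^sub>R h s - exp (l * s) *\<^sub>R k s)"
        unfolding G_def using lipschitz_on_normD[OF lip] by simp
      also have "\<dots> = L * (exp (l * s) * dist (h s) (k s))"
        by (simp add: dist_norm flip: scaleR_diff_right)
      also have "\<dots> \<le> L * (exp (l * s) * dist h k)"
        using L by (intro mult_left_mono dist_bounded) auto
      finally show ?thesis by (simp add: algebra_simps)
    qed
    then have "norm (exp (- (l * \<tau>)) *\<^sub>R integral {0..\<tau>} (\<lambda>s. G h s - G k s)) \<le> L * dist h k / l"
      using L by (intro norm_exp_weighted_integral_le[OF _ l _ \<tau>] continuous_intros contG) auto
    also have "integral {0..\<tau>} (\<lambda>s. G h s - G k s) = integral {0..\<tau>} (G h) - integral {0..\<tau>} (G k)"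
      by (intro integral_diff integrable_continuous_real contG)
    also have "L * dist h k / l = L / l * dist h k" by simp
    also have "\<dots> \<le> 1/2 * dist h k"
      using L by (intro mult_right_mono) (auto simp: l_def field_simps)
    finally show "dist (TT h t) (TT k t) \<le> 1/2 * dist h k"
      unfolding TT T_def \<tau>_def[symmetric] by (simp add: dist_norm algebra_simps)
  qed
  then obtain h where h: "TT h = h"
    using banach_fix_type[of "1/2" TT] by auto
  define y where "y t = exp (l * t) *\<^sub>R apply_bcontfun h t" for t
  have G_y: "G h = (\<lambda>s. F (y s))"
    by (auto simp: G_def y_def)
  have y_eq: "y t = x0 + integral {0..t} (G h)" if "t \<ge> 0" for t
  proof -
    have "y t = exp (l * t) *\<^sub>R T h t"
      unfolding y_def using h TT[of h] by simp
    also have "\<dots> = x0 + integral {0..t} (G h)"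
      using that by (simp add: T_def max_def flip: exp_add)
    finally show ?thesis .
  qed
  show ?thesis
  proof
    show "y 0 = x0" using y_eq[of 0] by simp
  next
    fix t :: real assume t: "t \<ge> 0"
    have "((\<lambda>u. x0 + integral {0..u} (G h)) has_vector_derivative G h t) (at t within {0..})"
      using der[OF t, of h] by (auto intro!: derivative_eq_intros)
    then have "(y has_vector_derivative G h t) (at t within {0..})"
      by (rule has_vector_derivative_transform[rotated 2]) (use t in \<open>auto simp: y_eq\<close>)
    then show "(y has_vector_derivative F (y t)) (at t within {0..})"
      by (simp add: G_y)
  qed
qed

section \<open>Mean value theorem and Barbalat's lemma\<close>

lemma real_mvt_within:
  fixes f f' :: "real \<Rightarrow> real"
  assumes "a \<le> b" "{a..b} \<subseteq> S"
    and "\<And>x. x \<in> {a..b} \<Longrightarrow> (f has_real_derivative f' x) (at x within S)"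
  obtains x where "x \<in> {a..b}" "f b - f a = f' x * (b - a)"
proof -
  have "\<exists>x\<in>{a..b}. f b - f a = (*) (f' x) (b - a)"
    using assms
    by (intro mvt_very_simple)
      (auto simp: has_field_derivative_def intro: has_derivative_subset)
  then show ?thesis using that by auto
qed

text \<open>Since \<open>G\<close> converges, its increment over a window of fixed length
  \<open>h\<close> tends to 0, and the mean value theorem makes \<open>f\<close> small somewhere in
  the window. The Lipschitz bound carries this smallness to the left end of the window.\<close>

lemma barbalat_lipschitz:
  fixes f G :: "real \<Rightarrow> real"
  assumes der: "\<And>t. t \<ge> 0 \<Longrightarrow> (G has_real_derivative f t) (at t within {0..})"
    and lim: "(G \<longlongrightarrow> l) at_top"
    and lip: "K-lipschitz_on {0..} f"
  shows "(f \<longlongrightarrow> 0) at_top"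
proof (rule tendstoI)
  fix e :: real assume e: "e > 0"
  have K: "K \<ge> 0" using lip by (rule lipschitz_on_nonneg)
  \<comment> \<open>The window is so short that \<open>f\<close> changes by less than
    \<open>e / 2\<close> across it; \<open>K + 1\<close> avoids a division by zero when
    \<open>K = 0\<close>.\<close>
  define h where "h = e / (2 * (K + 1))"
  have h: "h > 0" and Kh: "K * h < e / 2"
    using e K by (auto simp: h_def field_simps)
  have "((\<lambda>t. G (t + h)) \<longlongrightarrow> l) at_top"
    by (rule filterlim_compose[OF lim]) (rule filterlim_tendsto_add_at_top[OF tendsto_const filterlim_ident, of h, simplified add.commute])
  then have "((\<lambda>t. G (t + h) - G t) \<longlongrightarrow> l - l) at_top"
    using lim by (intro tendsto_diff)
  then have "\<forall>\<^sub>F t in at_top. dist (G (t + h) - G t) 0 < h * (e / 2)"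
    using h e by (intro tendstoD) auto
  then show "\<forall>\<^sub>F t in at_top. dist (f t) 0 < e"
    using eventually_ge_at_top[of 0]
  proof eventually_elim
    case (elim t)
    obtain x where x: "x \<in> {t..t+h}" "G (t + h) - G t = f x * (t + h - t)"
      using real_mvt_within[of t "t + h" "{0..}" G f] der elim h by auto
    have "h * \<bar>f x\<bar> < h * (e / 2)"
      using elim x h by (simp add: dist_norm abs_mult mult.commute)
    then have "\<bar>f x\<bar> < e / 2" using h by simp
    moreover have "\<bar>f x - f t\<bar> \<le> K * \<bar>x - t\<bar>"
      using lipschitz_onD[OF lip, of x t] elim x by (auto simp: dist_real_def)
    moreover have "K * \<bar>x - t\<bar> \<le> K * h"
      using x K by (intro mult_left_mono) auto
    ultimately show ?case using Kh by (simp add: dist_real_def)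
  qed
qed

lemma nonincreasing_bounded_below_tendsto:
  fixes f :: "real \<Rightarrow> real"
  assumes mono: "\<And>s t. 0 \<le> s \<Longrightarrow> s \<le> t \<Longrightarrow> f t \<le> f s" and bound: "\<And>t. t \<ge> 0 \<Longrightarrow> B \<le> f t"
  shows "\<exists>l. (f \<longlongrightarrow> l) at_top"
proof
  have bdd: "bdd_below (f ` {0..})" using bound by (auto intro!: bdd_belowI)
  show "(f \<longlongrightarrow> (INF t\<in>{0..}. f t)) at_top"
  proof (rule order_tendstoI)
    fix a assume a: "a < (INF t\<in>{0..}. f t)"
    show "\<forall>\<^sub>F t in at_top. a < f t"
      using eventually_ge_at_top[of 0]
      by eventually_elim (use a cINF_lower[OF bdd] in force)
  next
    fix a assume "(INF t\<in>{0..}. f t) < a"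
    then obtain s where s: "s \<ge> 0" "f s < a"
      using cINF_less_iff[OF _ bdd, of a] by auto
    show "\<forall>\<^sub>F t in at_top. f t < a"
      using eventually_ge_at_top[of s]
      by eventually_elim (use s mono in force)
  qed
qed

section \<open>Lipschitz functions on compact sets\<close>

text \<open>The constant is hidden under the quantifier so that the closure rules below chain by
  \<open>intro\<close> without any bookkeeping of constants.\<close>

definition lip_on :: "'a::metric_space set \<Rightarrow> ('a \<Rightarrow> 'b::metric_space) \<Rightarrow> bool" where
  "lip_on X f \<longleftrightarrow> (\<exists>L. L-lipschitz_on X f)"

lemma lip_onI:
  fixes f :: "'a::metric_space \<Rightarrow> 'b::metric_space"
  assumes "\<And>x y. x \<in> X \<Longrightarrow> y \<in> X \<Longrightarrow> dist (f x) (f y) \<le> L * dist x y"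
  shows "lip_on X f"
proof -
  have "\<bar>L\<bar>-lipschitz_on X f"
  proof (rule lipschitz_onI)
    fix x y assume "x \<in> X" "y \<in> X"
    then have "dist (f x) (f y) \<le> L * dist x y" by (rule assms)
    also have "\<dots> \<le> \<bar>L\<bar> * dist x y" by (intro mult_right_mono) auto
    finally show "dist (f x) (f y) \<le> \<bar>L\<bar> * dist x y" .
  qed simp
  then show ?thesis by (auto simp: lip_on_def)
qed

lemma lip_on_imp_continuous_on: "lip_on X f \<Longrightarrow> continuous_on X f"
  by (auto simp: lip_on_def lipschitz_on_continuous_on)

lemma lip_on_const: "lip_on X (\<lambda>x. k)"
  by (auto simp: lip_on_def intro: lipschitz_on_constant)

lemma lip_on_add:
  fixes f g :: "'a::metric_space \<Rightarrow> 'b::real_normed_vector"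
  shows "lip_on X f \<Longrightarrow> lip_on X g \<Longrightarrow> lip_on X (\<lambda>x. f x + g x)"
  by (auto simp: lip_on_def intro: lipschitz_on_add)

lemma lip_on_diff:
  fixes f g :: "'a::metric_space \<Rightarrow> 'b::real_normed_vector"
  shows "lip_on X f \<Longrightarrow> lip_on X g \<Longrightarrow> lip_on X (\<lambda>x. f x - g x)"
  by (auto simp: lip_on_def intro: lipschitz_on_diff)

lemma lip_on_minus:
  fixes f :: "'a::metric_space \<Rightarrow> 'b::real_normed_vector"
  shows "lip_on X f \<Longrightarrow> lip_on X (\<lambda>x. - f x)"
  by (auto simp: lip_on_def)

lemma lip_on_Pair: "lip_on X f \<Longrightarrow> lip_on X g \<Longrightarrow> lip_on X (\<lambda>x. (f x, g x))"
  by (auto simp: lip_on_def intro: lipschitz_on_Pair)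

lemma lip_on_compose: "lip_on Y g \<Longrightarrow> lip_on X f \<Longrightarrow> f ` X \<subseteq> Y \<Longrightarrow> lip_on X (\<lambda>x. g (f x))"
  unfolding lip_on_def by (blast intro: lipschitz_on_compose2 lipschitz_on_subset)

lemma lip_on_sum:
  fixes f :: "'i \<Rightarrow> 'a::metric_space \<Rightarrow> 'b::real_normed_vector"
  shows "(\<And>i. i \<in> I \<Longrightarrow> lip_on X (f i)) \<Longrightarrow> lip_on X (\<lambda>x. \<Sum>i\<in>I. f i x)"
  by (induction I rule: infinite_finite_induct) (auto intro: lip_on_const lip_on_add)

lemma lip_on_vec:
  fixes f :: "'a::metric_space \<Rightarrow> 'b::metric_space ^ 'n::finite"
  assumes "\<And>i. lip_on X (\<lambda>x. f x $ i)"
  shows "lip_on X f"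
proof -
  have "\<forall>i. \<exists>L. L-lipschitz_on X (\<lambda>x. f x $ i)"
    using assms by (simp add: lip_on_def)
  then obtain L where L: "\<And>i. (L i)-lipschitz_on X (\<lambda>x. f x $ i)" by metis
  show ?thesis
  proof (rule lip_onI)
    fix x y assume "x \<in> X" "y \<in> X"
    have "dist (f x) (f y) \<le> (\<Sum>i\<in>UNIV. dist (f x $ i) (f y $ i))"
      unfolding dist_vec_def by (rule L2_set_le_sum) simp
    also have "\<dots> \<le> (\<Sum>i\<in>UNIV. L i * dist x y)"
      using \<open>x \<in> X\<close> \<open>y \<in> X\<close> by (intro sum_mono lipschitz_onD[OF L])
    finally show "dist (f x) (f y) \<le> (\<Sum>i\<in>UNIV. L i) * dist x y"
      by (simp add: sum_distrib_right)
  qed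
qed

text \<open>Compactness bounds both factors, and the difference of products splits into a value of
  \<open>f\<close> times a difference of \<open>g\<close> plus a value of \<open>g\<close> times a
  difference of \<open>f\<close>.\<close>

lemma lip_on_mult:
  fixes f g :: "'a::metric_space \<Rightarrow> real"
  assumes X: "compact X" and f: "lip_on X f" and g: "lip_on X g"
  shows "lip_on X (\<lambda>x. f x * g x)"
proof -
  obtain K L where K: "K-lipschitz_on X f" and L: "L-lipschitz_on X g"
    using f g by (auto simp: lip_on_def)
  have "bounded (f ` X)" "bounded (g ` X)"
    using X f g by (auto intro!: compact_imp_bounded compact_continuous_image lip_on_imp_continuous_on)
  then obtain A B where A: "\<And>x. x \<in> X \<Longrightarrow> \<bar>f x\<bar> \<le> A" and B: "\<And>x. x \<in> X \<Longrightarrow> \<bar>g x\<bar> \<le> B"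
    by (auto simp: bounded_iff)
  show ?thesis
  proof (rule lip_onI)
    fix x y assume x: "x \<in> X" and y: "y \<in> X"
    have fK: "\<bar>f x - f y\<bar> \<le> K * dist x y" and gL: "\<bar>g x - g y\<bar> \<le> L * dist x y"
      using lipschitz_onD[OF K x y] lipschitz_onD[OF L x y] by (auto simp: dist_real_def)
    have "f x * g x - f y * g y = f x * (g x - g y) + g y * (f x - f y)"
      by (simp add: algebra_simps)
    then have "\<bar>f x * g x - f y * g y\<bar> \<le> \<bar>f x\<bar> * \<bar>g x - g y\<bar> + \<bar>g y\<bar> * \<bar>f x - f y\<bar>"
      by (metis abs_mult abs_triangle_ineq)
    also have "\<dots> \<le> A * (L * dist x y) + B * (K * dist x y)"
      using fK gL A[OF x] B[OF y] by (intro add_mono mult_mono) auto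
    finally show "dist (f x * g x) (f y * g y) \<le> (A * L + B * K) * dist x y"
      by (simp add: dist_real_def algebra_simps)
  qed
qed

lemma lip_on_positive_bounded_away:
  fixes f :: "'a::metric_space \<Rightarrow> real"
  assumes X: "compact X" and f: "lip_on X f" and pos: "\<And>x. x \<in> X \<Longrightarrow> f x > 0"
  obtains m where "m > 0" "\<And>x. x \<in> X \<Longrightarrow> m \<le> f x"
proof (cases "X = {}")
  case False
  then obtain x0 where "x0 \<in> X" "\<And>x. x \<in> X \<Longrightarrow> f x0 \<le> f x"
    using continuous_attains_inf[OF X False lip_on_imp_continuous_on[OF f]] by blast
  with pos that show ?thesis by blast
qed (use that[of 1] in auto)

text \<open>By compactness \<open>f\<close> stays above some \<open>m > 0\<close>, and on
  \<open>{m..}\<close> the inequality \<open>ln z \<le> z - 1\<close>, used at a quotient, makes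
  \<open>ln\<close> Lipschitz with constant \<open>1 / m\<close>.\<close>

lemma lip_on_ln:
  fixes f :: "'a::metric_space \<Rightarrow> real"
  assumes X: "compact X" and f: "lip_on X f" and pos: "\<And>x. x \<in> X \<Longrightarrow> f x > 0"
  shows "lip_on X (\<lambda>x. ln (f x))"
proof -
  obtain m where m: "m > 0" "\<And>x. x \<in> X \<Longrightarrow> m \<le> f x"
    using lip_on_positive_bounded_away[OF assms] by blast
  have "lip_on {m..} ln"
  proof (rule lip_onI)
    have le: "ln x - ln y \<le> 1 / m * \<bar>x - y\<bar>" if "x \<ge> m" "y \<ge> m" for x y
    proof -
      have "ln x - ln y = ln (x / y)" using that m by (simp add: ln_div)
      also have "\<dots> \<le> x / y - 1" using that m by (intro ln_le_minus_one) auto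
      also have "\<dots> = (x - y) / y" using that m by (simp add: field_simps)
      also have "\<dots> \<le> \<bar>x - y\<bar> / m" using that m by (intro frac_le) auto
      finally show ?thesis by simp
    qed
    fix x y :: real assume "x \<in> {m..}" "y \<in> {m..}"
    then show "dist (ln x) (ln y) \<le> 1 / m * dist x y"
      using le[of x y] le[of y x] by (auto simp: dist_real_def abs_le_iff abs_minus_commute)
  qed
  then show ?thesis using f by (rule lip_on_compose) (use m in auto)
qed

lemma lip_on_divide:
  fixes f g :: "'a::metric_space \<Rightarrow> real"
  assumes X: "compact X" and f: "lip_on X f" and g: "lip_on X g" and pos: "\<And>x. x \<in> X \<Longrightarrow> g x > 0"
  shows "lip_on X (\<lambda>x. f x / g x)"
proof -
  obtain m where m: "m > 0" "\<And>x. x \<in> X \<Longrightarrow> m \<le> g x"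
    using lip_on_positive_bounded_away[OF X g pos] by blast
  have "lip_on {m..} (inverse :: real \<Rightarrow> real)"
  proof (rule lip_onI)
    fix x y :: real assume xy: "x \<in> {m..}" "y \<in> {m..}"
    have "inverse x - inverse y = (y - x) / (x * y)" using xy m by (simp add: field_simps)
    then have "dist (inverse x) (inverse y) = \<bar>x - y\<bar> / (x * y)"
      using xy m by (simp add: dist_real_def abs_minus_commute abs_mult)
    also have "\<dots> \<le> \<bar>x - y\<bar> / (m * m)"
      using xy m by (intro divide_left_mono mult_mono mult_pos_pos) auto
    finally show "dist (inverse x) (inverse y) \<le> 1 / (m * m) * dist x y"
      by (simp add: dist_real_def)
  qed
  then have "lip_on X (\<lambda>x. inverse (g x))"
    using g by (rule lip_on_compose) (use m in auto)
  from lip_on_mult[OF X f this] show ?thesis by (simp add: divide_inverse)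
qed

lemma mem_cbox_vec:
  fixes a b x :: "'a::euclidean_space ^ 'n"
  shows "x \<in> cbox a b \<longleftrightarrow> (\<forall>i. x $ i \<in> cbox (a $ i) (b $ i))"
  by (auto simp: mem_box Basis_vec_def inner_axis)

lemma mem_box_vec:
  fixes a b x :: "'a::euclidean_space ^ 'n"
  shows "x \<in> box a b \<longleftrightarrow> (\<forall>i. x $ i \<in> box (a $ i) (b $ i))"
  by (auto simp: mem_box Basis_vec_def inner_axis)

section \<open>The scalar Kullback--Leibler divergence\<close>

text \<open>The Bregman divergence of \<open>x ln x\<close>. The correction \<open>- p + q\<close>
  makes every single term nonnegative for positive arguments, without any normalisation.\<close>

definition kld :: "real \<Rightarrow> real \<Rightarrow> real" where
  "kld p q = p * ln (p / q) - p + q"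

lemma kld_self [simp]: "kld p p = 0"
  by (simp add: kld_def)

text \<open>A Hellinger-type bound, obtained from \<open>ln x \<le> x - 1\<close> at
  \<open>x = sqrt q / sqrt p\<close>. It bounds \<open>q\<close> from above on sublevel sets and
  forces \<open>q\<close> towards \<open>p\<close> when the divergence is small.\<close>

lemma kld_ge_sqrt_diff:
  assumes "p > 0" "q > 0"
  shows "(sqrt q - sqrt p)\<^sup>2 \<le> kld p q"
proof -
  have "ln (sqrt q / sqrt p) \<le> sqrt q / sqrt p - 1"
    using assms by (intro ln_le_minus_one) auto
  then have "p * (ln q / 2 - ln p / 2) \<le> p * (sqrt q / sqrt p - 1)"
    using assms by (intro mult_left_mono) (auto simp: ln_div ln_sqrt)
  also have "p = sqrt p * sqrt p" using assms by simp
  then have "p * (sqrt q / sqrt p - 1) = sqrt p * sqrt q - p"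
    using assms by (simp add: field_simps)
  finally show ?thesis
    using assms by (simp add: kld_def power2_diff ln_div algebra_simps)
qed

lemma kld_nonneg: "p > 0 \<Longrightarrow> q > 0 \<Longrightarrow> kld p q \<ge> 0"
  using kld_ge_sqrt_diff[of p q] zero_le_power2 order_trans by blast

text \<open>The term \<open>p * ln (p / q)\<close> blows up as \<open>q\<close> tends to 0, which
  keeps \<open>q\<close> away from 0; the square-root bound limits \<open>q\<close> from
  above.\<close>

lemma kld_sublevel_bounds:
  assumes p: "p > 0"
  shows "\<exists>lo hi. lo > 0 \<and> (\<forall>q>0. kld p q \<le> B \<longrightarrow> lo < q \<and> q < hi)"
\<comment> \<open>Halving the lower bound and adding 1 to the upper one makes both inequalities
  strict, so that sublevel sets will lie in the interior of a box.\<close>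
proof (intro exI conjI allI impI)
  show "p * exp (- ((B + p) / p)) / 2 > 0" using p by simp
  fix q :: real assume q: "q > 0" "kld p q \<le> B"
  have "p * ln (p / q) \<le> B + p" using q by (simp add: kld_def)
  then have "ln (p / q) \<le> (B + p) / p" using p by (simp add: field_simps)
  then have "ln (p * exp (- ((B + p) / p))) \<le> ln q"
    using p q by (simp add: ln_mult ln_div)
  then have "p * exp (- ((B + p) / p)) \<le> q" using p q by (subst (asm) ln_le_cancel_iff) auto
  moreover have "0 < p * exp (- ((B + p) / p))" using p by simp
  ultimately show "p * exp (- ((B + p) / p)) / 2 < q" by linarith
  have "(sqrt q - sqrt p)\<^sup>2 \<le> B" using kld_ge_sqrt_diff[OF p q(1)] q by linarith
  then have "sqrt q - sqrt p \<le> sqrt B" by (rule real_le_rsqrt)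
  then have "sqrt q \<le> sqrt p + sqrt B" by simp
  then have "q \<le> (sqrt p + sqrt B)\<^sup>2"
    using q(1) by (metis less_eq_real_def real_sqrt_pow2 real_sqrt_ge_zero power_mono)
  then show "q < (sqrt p + sqrt B)\<^sup>2 + 1" by simp
qed

text \<open>The square-root bound puts \<open>sqrt q\<close> near \<open>sqrt p\<close>, and
  squaring is continuous. Stating the smallness of \<open>\<eta>\<close> through a filter lets
  finitely many coordinates share one \<open>\<eta>\<close>.\<close>

lemma kld_small_imp_close:
  assumes p: "p > 0" and e: "e > 0"
  shows "\<forall>\<^sub>F \<eta> in at_right 0. \<forall>q>0. kld p q \<le> \<eta> \<longrightarrow> \<bar>q - p\<bar> < e"
proof -
  have "isCont (\<lambda>x::real. x\<^sup>2) (sqrt p)" by (intro continuous_intros)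
  then obtain d where d: "d > 0" "\<And>x. \<bar>x - sqrt p\<bar> < d \<Longrightarrow> \<bar>x\<^sup>2 - p\<bar> < e"
    using e p unfolding continuous_at_eps_delta by (auto simp: dist_real_def)
  have "\<forall>q>0. kld p q \<le> \<eta> \<longrightarrow> \<bar>q - p\<bar> < e" if "\<eta> < d\<^sup>2" for \<eta>
  proof (intro allI impI)
    fix q :: real assume q: "q > 0" "kld p q \<le> \<eta>"
    have "(sqrt q - sqrt p)\<^sup>2 < d\<^sup>2" using kld_ge_sqrt_diff[OF p q(1)] q that by linarith
    then have "\<bar>sqrt q - sqrt p\<bar> < d" using d(1) by (metis abs_le_square_iff abs_of_pos not_le)
    from d(2)[OF this] show "\<bar>q - p\<bar> < e" using q by simp
  qed
  then show ?thesis using d(1) by (auto simp: eventually_at_right intro!: exI[of _ "d\<^sup>2"])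
qed

lemma kld_tendsto_0_imp_tendsto:
  assumes p: "p > 0" and q: "\<forall>\<^sub>F t in F. q t > 0" and lim: "((\<lambda>t. kld p (q t)) \<longlongrightarrow> 0) F"
  shows "(q \<longlongrightarrow> p) F"
proof (rule tendstoI)
  fix e :: real assume "e > 0"
  from kld_small_imp_close[OF p this]
  obtain b where b: "b > 0" "\<And>\<eta>. 0 < \<eta> \<Longrightarrow> \<eta> < b \<Longrightarrow> \<forall>q>0. kld p q \<le> \<eta> \<longrightarrow> \<bar>q - p\<bar> < e"
    by (auto simp: eventually_at_right_field)
  have "\<forall>\<^sub>F t in F. kld p (q t) < b / 2"
    using lim b(1) by (intro order_tendstoD(2)) auto
  with q show "\<forall>\<^sub>F t in F. dist (q t) p < e"
    by eventually_elim (use b(2)[of "b / 2"] b(1) in \<open>auto simp: dist_real_def\<close>)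
qed

lemma has_real_derivative_kld:
  assumes "(q has_real_derivative q') (at t within S)" "q t > 0" "p > 0"
  shows "((\<lambda>x. kld p (q x)) has_real_derivative (1 - p / q t) * q') (at t within S)"
  unfolding kld_def using assms
  by (auto intro!: derivative_eq_intros simp: field_simps power2_eq_square)

section \<open>The Lyapunov function\<close>

lemma usum_pos: "posu u \<Longrightarrow> usum u s > 0"
  by (auto simp: usum_def posu_def intro!: sum_pos)

lemma pol_pos: "posu u \<Longrightarrow> pol u s a > 0"
  using usum_pos[of u s] by (simp add: pol_def posu_def)

lemma sum_pol: "posu u \<Longrightarrow> (\<Sum>a\<in>UNIV. pol u s a) = 1"
  using usum_pos[of u s] by (simp add: pol_def usum_def flip: sum_divide_distrib)

lemma usum_times_pol: "posu u \<Longrightarrow> usum u s * pol u s a = u s a"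
  using usum_pos[of u s] by (simp add: pol_def)

lemma sum_rotate3: "(\<Sum>x\<in>A. \<Sum>y\<in>B. \<Sum>z\<in>C. f x y z) = (\<Sum>y\<in>B. \<Sum>z\<in>C. \<Sum>x\<in>A. f x y z)"
  by (subst sum.swap, intro sum.cong refl, rule sum.swap)

text \<open>Differentiating the logarithm contributes \<open>D s a - u s a * d s / usum u s\<close>,
  and these terms cancel when summed over the actions. The gradient of the entropy term is therefore
  just \<open>ln (pol u s a)\<close>.\<close>

lemma has_real_derivative_entropy:
  fixes D :: "'s::finite \<Rightarrow> 'b::finite \<Rightarrow> real"
  assumes "posu u"
  shows "((\<lambda>h. \<Sum>s\<in>UNIV. \<Sum>a\<in>UNIV. (u s a + h * D s a) * ln ((u s a + h * D s a) / usum (\<lambda>s a. u s a + h * D s a) s))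
    has_real_derivative (\<Sum>s\<in>UNIV. \<Sum>a\<in>UNIV. D s a * ln (pol u s a))) (at 0)"
proof -
  have pos: "u s a > 0" "usum u s > 0" for s a
    using assms usum_pos[of u s] by (auto simp: posu_def)
  have nz: "u s a \<noteq> 0" "usum u s \<noteq> 0" for s a
    using pos(1)[of s a] pos(2)[of s] by auto
  define d where "d s = (\<Sum>a\<in>UNIV. D s a)" for s
  have us: "usum (\<lambda>s a. u s a + h * D s a) s = usum u s + h * d s" for h s
    by (simp add: usum_def d_def sum.distrib sum_distrib_left)
  have "((\<lambda>h. \<Sum>s\<in>UNIV. \<Sum>a\<in>UNIV. (u s a + h * D s a) * ln ((u s a + h * D s a) / usum (\<lambda>s a. u s a + h * D s a) s))
    has_real_derivative (\<Sum>s\<in>UNIV. \<Sum>a\<in>UNIV. D s a * ln (pol u s a) + (D s a - u s a * d s / usum u s))) (at 0)"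
    unfolding us using pos nz
    by (intro DERIV_sum)
      (auto intro!: derivative_eq_intros simp: pol_def field_simps power2_eq_square)
  also have "(\<Sum>s\<in>UNIV. \<Sum>a\<in>UNIV. D s a * ln (pol u s a) + (D s a - u s a * d s / usum u s))
      = (\<Sum>s\<in>UNIV. \<Sum>a\<in>UNIV. D s a * ln (pol u s a)) + (\<Sum>s\<in>UNIV. d s - usum u s * d s / usum u s)"
    by (simp add: sum.distrib sum_subtractf d_def usum_def sum_distrib_right sum_divide_distrib)
  also have "(\<Sum>s\<in>UNIV. d s - usum u s * d s / usum u s) = 0"
    using nz by simp
  finally show ?thesis by simp
qed

locale entropy_mdp =
  fixes P :: "'b::finite \<Rightarrow> 's::finite \<Rightarrow> 's \<Rightarrow> real"
    and r :: "'s \<Rightarrow> 'b \<Rightarrow> real"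
    and \<gamma> \<tau> \<alpha> c :: real
    and vs :: "'s \<Rightarrow> real" and us :: "'s \<Rightarrow> 'b \<Rightarrow> real"
  assumes P_nonneg: "P a s s' \<ge> 0"
    and P_stoch: "(\<Sum>s'\<in>UNIV. P a s s') = 1"
    and gamma: "0 < \<gamma>" "\<gamma> < 1"
    and tau: "\<tau> > 0"
    and alpha: "\<alpha> > 0"
    and c: "0 < c" "c < 1"
    and saddle: "saddle_point \<alpha> \<tau> \<gamma> P r vs us"
begin

abbreviation "K \<equiv> Kmat \<gamma> P"

section \<open>First-order conditions at the saddle point\<close>

lemma posu_us: "posu us"
  using saddle by (simp add: saddle_point_def)

text \<open>The objective is varied along its own gradient \<open>D\<close> in \<open>v\<close>, so
  the derivative at \<open>h = 0\<close> is the squared norm of \<open>D\<close>, which must vanish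
  at a minimum.\<close>

lemma saddle_foc_v: "\<alpha> * vs s' = (\<Sum>s\<in>UNIV. \<Sum>a\<in>UNIV. K a s s' * us s a)"
proof -
  define k where "k s' = (\<Sum>s\<in>UNIV. \<Sum>a\<in>UNIV. K a s s' * us s a)" for s'
  define D where "D s' = \<alpha> * vs s' - k s'" for s'
  define f where "f h = Efun \<alpha> \<tau> \<gamma> P r (\<lambda>s. vs s + h * D s) us" for h
  have "(f has_real_derivative \<alpha> * (\<Sum>s\<in>UNIV. vs s * D s)
      - (\<Sum>s\<in>UNIV. \<Sum>a\<in>UNIV. us s a * (\<Sum>s'\<in>UNIV. K a s s' * D s'))) (at 0)"
    unfolding f_def Efun_def
    by (auto intro!: derivative_eq_intros simp: sum_distrib_left sum_negf algebra_simps)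
  moreover have "(\<Sum>s\<in>UNIV. \<Sum>a\<in>UNIV. us s a * (\<Sum>s'\<in>UNIV. K a s s' * D s'))
      = (\<Sum>s'\<in>UNIV. D s' * k s')"
    unfolding k_def sum_distrib_left by (subst (2) sum_rotate3) (simp add: mult_ac)
  moreover have "\<alpha> * (\<Sum>s\<in>UNIV. vs s * D s) - (\<Sum>s\<in>UNIV. D s * k s) = (\<Sum>s\<in>UNIV. (D s)\<^sup>2)"
    unfolding sum_distrib_left sum_subtractf[symmetric]
    by (intro sum.cong refl) (simp add: D_def power2_eq_square algebra_simps)
  ultimately have "(f has_real_derivative (\<Sum>s\<in>UNIV. (D s)\<^sup>2)) (at 0)"
    by simp
  moreover have "f 0 \<le> f h" for h
    using saddle by (simp add: f_def saddle_point_def)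
  ultimately have "(\<Sum>s\<in>UNIV. (D s)\<^sup>2) = 0"
    using DERIV_local_min[of f _ 0 1] by auto
  then have "D s' = 0" by (subst (asm) sum_nonneg_eq_0_iff) auto
  then show ?thesis by (simp add: D_def k_def)
qed

text \<open>Again a variation along the gradient \<open>D\<close>, now at a maximum. Only small
  \<open>h\<close> are admissible, because the perturbed occupancies must stay positive; a local
  maximum suffices.\<close>

lemma saddle_foc_u: "r s a - (\<Sum>s'\<in>UNIV. K a s s' * vs s') = \<tau> * ln (pol us s a)"
proof -
  define D where "D s a = r s a - (\<Sum>s'\<in>UNIV. K a s s' * vs s') - \<tau> * ln (pol us s a)" for s a
  define f where "f h = Efun \<alpha> \<tau> \<gamma> P r vs (\<lambda>s a. us s a + h * D s a)" for h
  have "(f has_real_derivative (\<Sum>s\<in>UNIV. \<Sum>a\<in>UNIV. D s a * (r s a - (\<Sum>s'\<in>UNIV. K a s s' * vs s')))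
      - \<tau> * (\<Sum>s\<in>UNIV. \<Sum>a\<in>UNIV. D s a * ln (pol us s a))) (at 0)"
    unfolding f_def Efun_def
    by (rule derivative_eq_intros has_real_derivative_entropy[OF posu_us] refl)+ simp
  moreover have "(\<Sum>s\<in>UNIV. \<Sum>a\<in>UNIV. D s a * (r s a - (\<Sum>s'\<in>UNIV. K a s s' * vs s')))
      - \<tau> * (\<Sum>s\<in>UNIV. \<Sum>a\<in>UNIV. D s a * ln (pol us s a)) = (\<Sum>s\<in>UNIV. \<Sum>a\<in>UNIV. (D s a)\<^sup>2)"
    unfolding sum_distrib_left sum_subtractf[symmetric]
    by (intro sum.cong refl) (simp add: D_def power2_eq_square algebra_simps)
  ultimately have der: "(f has_real_derivative (\<Sum>s\<in>UNIV. \<Sum>a\<in>UNIV. (D s a)\<^sup>2)) (at 0)"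
    by simp
  have "\<forall>\<^sub>F h in nhds 0. us s a + h * D s a > 0" for s a
  proof -
    have "((\<lambda>h. us s a + h * D s a) \<longlongrightarrow> us s a + 0 * D s a) (nhds 0)"
      by (intro tendsto_intros filterlim_ident)
    then show ?thesis
      using posu_us by (intro order_tendstoD(1)) (auto simp: posu_def)
  qed
  then have "\<forall>\<^sub>F h in nhds 0. posu (\<lambda>s a. us s a + h * D s a)"
    by (simp add: posu_def eventually_all_finite)
  then obtain d where d: "d > 0" "\<And>h. \<bar>h\<bar> < d \<Longrightarrow> posu (\<lambda>s a. us s a + h * D s a)"
    by (auto simp: eventually_nhds_metric dist_real_def)
  have "f h \<le> f 0" if "\<bar>0 - h\<bar> < d" for h
    using saddle d(2)[of h] that by (simp add: f_def saddle_point_def)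
  then have "(\<Sum>s\<in>UNIV. \<Sum>a\<in>UNIV. (D s a)\<^sup>2) = 0"
    using DERIV_local_max[OF der d(1)] by blast
  then have "D s a = 0"
    by (subst (asm) sum_nonneg_eq_0_iff) (auto simp: sum_nonneg sum_nonneg_eq_0_iff)
  then show ?thesis by (simp add: D_def)
qed

section \<open>Lyapunov function and its decay along the flow\<close>

definition lyap :: "('s \<Rightarrow> real) \<Rightarrow> ('s \<Rightarrow> 'b \<Rightarrow> real) \<Rightarrow> real" where
  "lyap v u = \<alpha> / 2 * (\<Sum>s\<in>UNIV. (v s - vs s)\<^sup>2)
     + \<tau> * ((\<Sum>s\<in>UNIV. \<Sum>a\<in>UNIV. kld (us s a) (u s a))
            + c / (1 - c) * (\<Sum>s\<in>UNIV. kld (usum us s) (usum u s)))"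

definition diss :: "('s \<Rightarrow> real) \<Rightarrow> ('s \<Rightarrow> 'b \<Rightarrow> real) \<Rightarrow> real" where
  "diss v u = \<alpha> * (\<Sum>s\<in>UNIV. (v s - vs s)\<^sup>2)
     + \<tau> * (\<Sum>s\<in>UNIV. \<Sum>a\<in>UNIV. (u s a - us s a) * (ln (pol u s a) - ln (pol us s a)))"

lemma Fu_eq:
  assumes "posu u"
  shows "Fu c \<tau> \<gamma> P r v u s a =
    - u s a * (gvec \<tau> \<gamma> P r v u s a - c * (\<Sum>b\<in>UNIV. pol u s b * gvec \<tau> \<gamma> P r v u s b))"
  unfolding Fu_def usum_times_pol[OF assms, of s a, symmetric] by (simp add: algebra_simps)

text \<open>Because the policy sums to 1, the column sums of
  \<open>diag(\<pi>) - c \<pi> \<pi>^T\<close> are \<open>(1 - c) \<pi>\<close>. The weight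
  \<open>c / (1 - c)\<close> in \<open>lyap\<close> compensates this factor
  \<open>1 - c\<close>.\<close>

lemma sum_Fu:
  assumes "posu u"
  shows "(\<Sum>a\<in>UNIV. Fu c \<tau> \<gamma> P r v u s a) =
    - (1 - c) * usum u s * (\<Sum>b\<in>UNIV. pol u s b * gvec \<tau> \<gamma> P r v u s b)"
proof -
  define G where "G = (\<Sum>b\<in>UNIV. pol u s b * gvec \<tau> \<gamma> P r v u s b)"
  have "(\<Sum>a\<in>UNIV. Fu c \<tau> \<gamma> P r v u s a) = - usum u s * (G - c * (\<Sum>a\<in>UNIV. pol u s a) * G)"
    unfolding Fu_def G_def[symmetric]
    by (simp add: sum_negf sum_subtractf flip: sum_distrib_left sum_distrib_right G_def)
  then show ?thesis by (simp add: sum_pol[OF assms] algebra_simps flip: G_def)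
qed

text \<open>The inverse Hessian property in coordinates: the gradient of the divergence in
  \<open>u\<close> is the Hessian of the potential applied to \<open>u - us\<close>, so the metric
  cancels. Concretely, the rank-one part of the matrix leaves
  \<open>c * G * (usum u s - usum us s)\<close> over, and the mass term removes it.\<close>

lemma metric_gradient_pairing:
  assumes u: "posu u"
  shows "(\<Sum>a\<in>UNIV. (1 - us s a / u s a) * Fu c \<tau> \<gamma> P r v u s a)
     + c / (1 - c) * ((1 - usum us s / usum u s) * (\<Sum>a\<in>UNIV. Fu c \<tau> \<gamma> P r v u s a))
     = - (\<Sum>a\<in>UNIV. (u s a - us s a) * gvec \<tau> \<gamma> P r v u s a)"
proof -
  define G where "G = (\<Sum>b\<in>UNIV. pol u s b * gvec \<tau> \<gamma> P r v u s b)"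
  have "(1 - us s a / u s a) * Fu c \<tau> \<gamma> P r v u s a
      = - ((u s a - us s a) * gvec \<tau> \<gamma> P r v u s a) + c * G * (u s a - us s a)" for a
  proof -
    have "u s a > 0" using u by (simp add: posu_def)
    then show ?thesis unfolding Fu_eq[OF u] G_def[symmetric] by (simp add: field_simps)
  qed
  then have "(\<Sum>a\<in>UNIV. (1 - us s a / u s a) * Fu c \<tau> \<gamma> P r v u s a)
      = - (\<Sum>a\<in>UNIV. (u s a - us s a) * gvec \<tau> \<gamma> P r v u s a) + c * G * (usum u s - usum us s)"
    by (simp add: sum.distrib sum_negf usum_def sum_distrib_left sum_subtractf right_diff_distrib)
  moreover have "c / (1 - c) * ((1 - usum us s / usum u s) * (\<Sum>a\<in>UNIV. Fu c \<tau> \<gamma> P r v u s a))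
      = - c * G * (usum u s - usum us s)"
  proof -
    have "c / (1 - c) * (1 - c) = c" "(1 - usum us s / usum u s) * usum u s = usum u s - usum us s"
      using c usum_pos[OF u, of s] by (auto simp: field_simps)
    moreover have "k * (q * (- (1 - c) * w * G)) = - (k * (1 - c)) * G * (q * w)" for k q w
      by (simp add: algebra_simps)
    ultimately show ?thesis unfolding sum_Fu[OF u] G_def[symmetric] by simp
  qed
  ultimately show ?thesis by simp
qed

text \<open>Subtracting the first-order condition rewrites the field in deviations from the saddle
  point, as \<open>alpha_Fv\<close> does for \<open>v\<close>. Both contain the same
  \<open>K\<close>, which is what lets the coupling cancel.\<close>

lemma tau_gvec:
  "\<tau> * gvec \<tau> \<gamma> P r v u s a = \<tau> * (ln (pol u s a) - ln (pol us s a)) + (\<Sum>s'\<in>UNIV. K a s s' * (v s' - vs s'))"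
  using tau saddle_foc_u[of s a]
  by (simp add: gvec_def right_diff_distrib sum_subtractf field_simps)

lemma alpha_Fv:
  "\<alpha> * Fv \<alpha> \<gamma> P v u s' = - \<alpha> * (v s' - vs s') + (\<Sum>s\<in>UNIV. \<Sum>a\<in>UNIV. K a s s' * (u s a - us s a))"
  using alpha saddle_foc_v[of s']
  by (simp add: Fv_def right_diff_distrib sum_subtractf field_simps)

text \<open>The pairing identity reduces the \<open>u\<close> part to \<open>gvec\<close>. The
  coupling then occurs as one triple sum with both signs, up to the order of summation, and only the
  terms of \<open>diss\<close> remain.\<close>

lemma lyap_flow_identity:
  assumes u: "posu u"
  shows "\<alpha> * (\<Sum>s\<in>UNIV. (v s - vs s) * Fv \<alpha> \<gamma> P v u s)
    + \<tau> * ((\<Sum>s\<in>UNIV. \<Sum>a\<in>UNIV. (1 - us s a / u s a) * Fu c \<tau> \<gamma> P r v u s a)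
       + c / (1 - c) * (\<Sum>s\<in>UNIV. (1 - usum us s / usum u s) * (\<Sum>a\<in>UNIV. Fu c \<tau> \<gamma> P r v u s a)))
    = - diss v u"
proof -
  have 1: "(\<Sum>s\<in>UNIV. \<Sum>a\<in>UNIV. (1 - us s a / u s a) * Fu c \<tau> \<gamma> P r v u s a)
       + c / (1 - c) * (\<Sum>s\<in>UNIV. (1 - usum us s / usum u s) * (\<Sum>a\<in>UNIV. Fu c \<tau> \<gamma> P r v u s a))
     = - (\<Sum>s\<in>UNIV. \<Sum>a\<in>UNIV. (u s a - us s a) * gvec \<tau> \<gamma> P r v u s a)"
    unfolding sum_distrib_left[of "c / (1 - c)"] sum.distrib[symmetric] metric_gradient_pairing[OF u]
    by (simp add: sum_negf)
  have 2: "\<tau> * (\<Sum>s\<in>UNIV. \<Sum>a\<in>UNIV. (u s a - us s a) * gvec \<tau> \<gamma> P r v u s a)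
     = \<tau> * (\<Sum>s\<in>UNIV. \<Sum>a\<in>UNIV. (u s a - us s a) * (ln (pol u s a) - ln (pol us s a)))
       + (\<Sum>s\<in>UNIV. \<Sum>a\<in>UNIV. \<Sum>s'\<in>UNIV. (u s a - us s a) * (K a s s' * (v s' - vs s')))"
  proof -
    have "\<tau> * ((u s a - us s a) * gvec \<tau> \<gamma> P r v u s a)
       = \<tau> * ((u s a - us s a) * (ln (pol u s a) - ln (pol us s a)))
         + (\<Sum>s'\<in>UNIV. (u s a - us s a) * (K a s s' * (v s' - vs s')))" for s a
      using tau_gvec[of v u s a] by (simp add: mult.left_commute[of \<tau>] distrib_left sum_distrib_left)
    then show ?thesis by (simp add: sum_distrib_left sum.distrib)
  qed
  have 3: "\<alpha> * (\<Sum>s\<in>UNIV. (v s - vs s) * Fv \<alpha> \<gamma> P v u s)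
     = - \<alpha> * (\<Sum>s\<in>UNIV. (v s - vs s)\<^sup>2)
       + (\<Sum>s'\<in>UNIV. \<Sum>s\<in>UNIV. \<Sum>a\<in>UNIV. (u s a - us s a) * (K a s s' * (v s' - vs s')))"
  proof -
    have "\<alpha> * ((v s' - vs s') * Fv \<alpha> \<gamma> P v u s') = - \<alpha> * (v s' - vs s')\<^sup>2
         + (\<Sum>s\<in>UNIV. \<Sum>a\<in>UNIV. (u s a - us s a) * (K a s s' * (v s' - vs s')))" for s'
      unfolding mult.left_commute[of \<alpha>] alpha_Fv distrib_left sum_distrib_left
      by (simp add: power2_eq_square mult_ac)
    then show ?thesis by (simp add: sum_distrib_left sum_subtractf sum_negf)
  qed
  have 4: "(\<Sum>s'\<in>UNIV. \<Sum>s\<in>UNIV. \<Sum>a\<in>UNIV. (u s a - us s a) * (K a s s' * (v s' - vs s')))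
     = (\<Sum>s\<in>UNIV. \<Sum>a\<in>UNIV. \<Sum>s'\<in>UNIV. (u s a - us s a) * (K a s s' * (v s' - vs s')))"
    by (rule sum_rotate3)
  show ?thesis unfolding 1 diss_def using 2 3 4 by simp
qed

lemma lyap_has_derivative:
  assumes u: "posu (U t)"
    and V: "\<And>s. ((\<lambda>x. V x s) has_real_derivative Fv \<alpha> \<gamma> P (V t) (U t) s) (at t within S)"
    and U: "\<And>s a. ((\<lambda>x. U x s a) has_real_derivative Fu c \<tau> \<gamma> P r (V t) (U t) s a) (at t within S)"
  shows "((\<lambda>x. lyap (V x) (U x)) has_real_derivative - diss (V t) (U t)) (at t within S)"
proof -
  have usum': "((\<lambda>x. usum (U x) s) has_real_derivative (\<Sum>a\<in>UNIV. Fu c \<tau> \<gamma> P r (V t) (U t) s a)) (at t within S)" for s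
    unfolding usum_def by (intro DERIV_sum U)
  have kld1: "((\<lambda>x. kld (us s a) (U x s a)) has_real_derivative
      (1 - us s a / U t s a) * Fu c \<tau> \<gamma> P r (V t) (U t) s a) (at t within S)" for s a
    using u posu_us by (intro has_real_derivative_kld U) (auto simp: posu_def)
  have kld2: "((\<lambda>x. kld (usum us s) (usum (U x) s)) has_real_derivative
      (1 - usum us s / usum (U t) s) * (\<Sum>a\<in>UNIV. Fu c \<tau> \<gamma> P r (V t) (U t) s a)) (at t within S)" for s
    using usum_pos[OF u] usum_pos[OF posu_us] by (intro has_real_derivative_kld usum') auto
  have "((\<lambda>x. (V x s - vs s)\<^sup>2) has_real_derivative 2 * ((V t s - vs s) * Fv \<alpha> \<gamma> P (V t) (U t) s)) (at t within S)" for s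
    by (auto intro!: derivative_eq_intros V)
  then have "((\<lambda>x. lyap (V x) (U x)) has_real_derivative
     \<alpha> / 2 * (\<Sum>s\<in>UNIV. 2 * ((V t s - vs s) * Fv \<alpha> \<gamma> P (V t) (U t) s))
    + \<tau> * ((\<Sum>s\<in>UNIV. \<Sum>a\<in>UNIV. (1 - us s a / U t s a) * Fu c \<tau> \<gamma> P r (V t) (U t) s a)
       + c / (1 - c) * (\<Sum>s\<in>UNIV. (1 - usum us s / usum (U t) s) * (\<Sum>a\<in>UNIV. Fu c \<tau> \<gamma> P r (V t) (U t) s a)))) (at t within S)"
    unfolding lyap_def by (intro DERIV_add DERIV_cmult DERIV_sum kld1 kld2)
  then show ?thesis
    using lyap_flow_identity[OF u, of "V t"] by (simp add: sum_distrib_left[symmetric])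
qed

section \<open>Lower bounds for the dissipation rate and the Lyapunov function\<close>

text \<open>Each occupancy is mass times policy. Policies sum to 1, so the corrections
  \<open>- p + q\<close> in \<open>kld\<close> cancel over the actions and Kullback-Leibler
  divergences in both directions appear, weighted by the masses.\<close>

lemma policy_dissipation:
  assumes u: "posu u"
  shows "(\<Sum>a\<in>UNIV. (u s a - us s a) * (ln (pol u s a) - ln (pol us s a)))
    = usum u s * (\<Sum>a\<in>UNIV. kld (pol u s a) (pol us s a)) + usum us s * (\<Sum>a\<in>UNIV. kld (pol us s a) (pol u s a))"
proof -
  have kl: "(\<Sum>a\<in>UNIV. kld (pol w s a) (pol w' s a)) = (\<Sum>a\<in>UNIV. pol w s a * (ln (pol w s a) - ln (pol w' s a)))"
    if "posu w" "posu w'" for w w' :: "'s \<Rightarrow> 'b \<Rightarrow> real"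
    using that pol_pos[OF that(1), THEN less_imp_neq, THEN not_sym] pol_pos[OF that(2), THEN less_imp_neq, THEN not_sym]
    by (simp add: kld_def sum.distrib sum_subtractf sum_pol ln_div)
  show ?thesis
    unfolding kl[OF u posu_us] kl[OF posu_us u] sum_distrib_left mult.assoc[symmetric] usum_times_pol[OF u] usum_times_pol[OF posu_us]
    unfolding sum.distrib[symmetric] by (simp add: algebra_simps)
qed

text \<open>Of the two divergences, the one weighted by \<open>usum us s\<close> is kept: this
  weight does not vary with \<open>u\<close>, so small dissipation alone forces the policy towards
  that of the saddle point.\<close>

lemma policy_dissipation_ge:
  assumes u: "posu u"
  shows "usum us s * kld (pol us s a) (pol u s a)
    \<le> (\<Sum>a\<in>UNIV. (u s a - us s a) * (ln (pol u s a) - ln (pol us s a)))"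
proof -
  note nn = kld_nonneg[OF pol_pos pol_pos, OF u posu_us] kld_nonneg[OF pol_pos pol_pos, OF posu_us u]
  have "usum us s * kld (pol us s a) (pol u s a) \<le> usum us s * (\<Sum>a\<in>UNIV. kld (pol us s a) (pol u s a))"
    using usum_pos[OF posu_us, of s] nn by (intro mult_left_mono member_le_sum) auto
  also have "\<dots> \<le> usum u s * (\<Sum>a\<in>UNIV. kld (pol u s a) (pol us s a)) + \<dots>"
    using usum_pos[OF u, of s] nn by (simp add: sum_nonneg)
  finally show ?thesis unfolding policy_dissipation[OF u] .
qed

lemma policy_dissipation_nonneg:
  assumes u: "posu u"
  shows "0 \<le> (\<Sum>a\<in>UNIV. (u s a - us s a) * (ln (pol u s a) - ln (pol us s a)))"
  using usum_pos[OF u, of s] usum_pos[OF posu_us, of s]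
    kld_nonneg[OF pol_pos pol_pos, OF u posu_us] kld_nonneg[OF pol_pos pol_pos, OF posu_us u]
  unfolding policy_dissipation[OF u]
  by (intro add_nonneg_nonneg mult_nonneg_nonneg sum_nonneg) auto

lemma diss_ge_v:
  assumes u: "posu u"
  shows "\<alpha> * (v s - vs s)\<^sup>2 \<le> diss v u"
proof -
  have "0 \<le> (\<Sum>s\<in>UNIV. \<Sum>a\<in>UNIV. (u s a - us s a) * (ln (pol u s a) - ln (pol us s a)))"
    by (rule sum_nonneg) (rule policy_dissipation_nonneg[OF u])
  moreover have "(v s - vs s)\<^sup>2 \<le> (\<Sum>s\<in>UNIV. (v s - vs s)\<^sup>2)"
    by (intro member_le_sum) auto
  ultimately show ?thesis unfolding diss_def using alpha tau by (simp add: add_increasing2)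
qed

lemma diss_ge_u:
  assumes u: "posu u"
  shows "\<tau> * (usum us s * kld (pol us s a) (pol u s a)) \<le> diss v u"
proof -
  have "usum us s * kld (pol us s a) (pol u s a)
      \<le> (\<Sum>a\<in>UNIV. (u s a - us s a) * (ln (pol u s a) - ln (pol us s a)))"
    by (rule policy_dissipation_ge[OF u])
  also have "\<dots> \<le> (\<Sum>s\<in>UNIV. \<Sum>a\<in>UNIV. (u s a - us s a) * (ln (pol u s a) - ln (pol us s a)))"
    using policy_dissipation_nonneg[OF u]
    by (intro member_le_sum[of s UNIV "\<lambda>s. \<Sum>a\<in>UNIV. (u s a - us s a) * (ln (pol u s a) - ln (pol us s a))"]) auto
  finally have "\<tau> * (usum us s * kld (pol us s a) (pol u s a))
      \<le> \<tau> * (\<Sum>s\<in>UNIV. \<Sum>a\<in>UNIV. (u s a - us s a) * (ln (pol u s a) - ln (pol us s a)))"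
    using tau by (intro mult_left_mono) auto
  then show ?thesis unfolding diss_def using alpha by (simp add: add_increasing sum_nonneg)
qed

lemma diss_nonneg: "posu u \<Longrightarrow> diss v u \<ge> 0"
  using diss_ge_v[of u v undefined] alpha by (meson mult_nonneg_nonneg order_trans zero_le_power2 less_imp_le)

lemma
  assumes u: "posu u"
  shows lyap_ge_v: "\<alpha> / 2 * (v s - vs s)\<^sup>2 \<le> lyap v u"
    and lyap_ge_u: "\<tau> * kld (us s a) (u s a) \<le> lyap v u"
proof -
  have k: "kld (us s a) (u s a) \<ge> 0" "kld (usum us s) (usum u s) \<ge> 0" for s a
    using u posu_us usum_pos[OF u, of s] usum_pos[OF posu_us, of s] by (auto intro!: kld_nonneg simp: posu_def)
  have v1: "(v s - vs s)\<^sup>2 \<le> (\<Sum>s\<in>UNIV. (v s - vs s)\<^sup>2)"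
    by (intro member_le_sum) auto
  have u1: "kld (us s a) (u s a) \<le> (\<Sum>s\<in>UNIV. \<Sum>a\<in>UNIV. kld (us s a) (u s a))"
  proof -
    have "kld (us s a) (u s a) \<le> (\<Sum>a\<in>UNIV. kld (us s a) (u s a))"
      using k by (intro member_le_sum) auto
    also have "\<dots> \<le> (\<Sum>s\<in>UNIV. \<Sum>a\<in>UNIV. kld (us s a) (u s a))"
      using k by (intro member_le_sum[of s UNIV "\<lambda>s. \<Sum>a\<in>UNIV. kld (us s a) (u s a)"]) (auto intro: sum_nonneg)
    finally show ?thesis .
  qed
  have w: "0 \<le> c / (1 - c) * (\<Sum>s\<in>UNIV. kld (usum us s) (usum u s))"
    using c k by (intro mult_nonneg_nonneg sum_nonneg) auto
  have "0 \<le> \<tau> * ((\<Sum>s\<in>UNIV. \<Sum>a\<in>UNIV. kld (us s a) (u s a))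
            + c / (1 - c) * (\<Sum>s\<in>UNIV. kld (usum us s) (usum u s)))"
    using tau w k by (intro mult_nonneg_nonneg[of \<tau>] add_nonneg_nonneg w) (auto intro: sum_nonneg)
  then show "\<alpha> / 2 * (v s - vs s)\<^sup>2 \<le> lyap v u"
    unfolding lyap_def using v1 alpha by (intro add_increasing2 mult_left_mono) auto
  show "\<tau> * kld (us s a) (u s a) \<le> lyap v u"
    unfolding lyap_def using alpha tau w u1
    by (intro add_increasing[of "\<alpha> / 2 * _"] mult_left_mono) (auto intro!: mult_nonneg_nonneg sum_nonneg)
qed

lemma lyap_nonneg: "posu u \<Longrightarrow> lyap v u \<ge> 0"
  using lyap_ge_v[of u v undefined] alpha by (meson half_gt_zero mult_nonneg_nonneg order_trans zero_le_power2 less_imp_le)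

lemma lyap_saddle: "lyap vs us = 0"
  by (simp add: lyap_def)

lemma solution_lyap_nonincreasing:
  assumes sol: "is_solution \<alpha> c \<tau> \<gamma> P r V U" and "0 \<le> s" "s \<le> t"
  shows "lyap (V t) (U t) \<le> lyap (V s) (U s)"
proof -
  have "((\<lambda>x. lyap (V x) (U x)) has_real_derivative - diss (V x) (U x)) (at x within {0..})" if "x \<ge> 0" for x
    using sol that by (intro lyap_has_derivative) (auto simp: is_solution_def)
  then obtain x where x: "x \<in> {s..t}" "lyap (V t) (U t) - lyap (V s) (U s) = - diss (V x) (U x) * (t - s)"
    using real_mvt_within[of s t "{0..}" "\<lambda>x. lyap (V x) (U x)" "\<lambda>x. - diss (V x) (U x)"] assms by auto
  have "diss (V x) (U x) \<ge> 0"
    using sol x assms by (intro diss_nonneg) (auto simp: is_solution_def)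
  then have "diss (V x) (U x) * (t - s) \<ge> 0" using assms by simp
  with x show ?thesis by simp
qed

end

section \<open>The state space as a Euclidean space\<close>

abbreviation vpart :: "(real ^ 's) \<times> (real ^ 'b ^ 's) \<Rightarrow> 's \<Rightarrow> real" where
  "vpart z \<equiv> \<lambda>s. fst z $ s"

abbreviation upart :: "(real ^ 's) \<times> (real ^ 'b ^ 's) \<Rightarrow> 's \<Rightarrow> 'b \<Rightarrow> real" where
  "upart z \<equiv> \<lambda>s a. snd z $ s $ a"

text \<open>Carries a pair of functions into a Euclidean space of finite Cartesian vectors, where
  compact boxes, nearest-point projections and the global existence result for Lipschitz fields
  apply.\<close>

definition pack :: "('s \<Rightarrow> real) \<Rightarrow> ('s \<Rightarrow> 'b \<Rightarrow> real) \<Rightarrow> (real ^ 's::finite) \<times> (real ^ 'b::finite ^ 's)" where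
  "pack v u = (\<chi> s. v s, \<chi> s a. u s a)"

lemma parts_pack [simp]: "fst (pack v u) $ s = v s" "snd (pack v u) $ s $ a = u s a"
  by (auto simp: pack_def)

lemma parts_pack_fun [simp]: "vpart (pack v u) = v" "upart (pack v u) = u"
  by (auto simp: fun_eq_iff)

lemma mem_box_Pair:
  fixes a c x :: "'a::euclidean_space" and b d y :: "'b::euclidean_space"
  shows "(x, y) \<in> box (a, b) (c, d) \<longleftrightarrow> x \<in> box a c \<and> y \<in> box b d"
  by (auto simp: mem_box Basis_prod_def ball_Un)

lemma dist_pack: "dist (pack v u) (pack v' u') = dist_vu v u v' u'"
  by (simp add: dist_vu_def pack_def dist_Pair_Pair dist_vec_def L2_set_def dist_real_def sum_nonneg)

lemma dist_vu_le:
  fixes v v' :: "'s::finite \<Rightarrow> real" and u u' :: "'s \<Rightarrow> 'b::finite \<Rightarrow> real"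
  assumes "\<And>s. \<bar>v s - v' s\<bar> \<le> e" "\<And>s a. \<bar>u s a - u' s a\<bar> \<le> e"
  shows "dist_vu v u v' u' \<le> sqrt (real CARD('s) + real CARD('s) * real CARD('b)) * e"
proof -
  have e: "e \<ge> 0" using assms(1)[of undefined] by linarith
  have sq: "(v s - v' s)\<^sup>2 \<le> e\<^sup>2" "(u s a - u' s a)\<^sup>2 \<le> e\<^sup>2" for s a
    using assms e by (auto intro!: abs_le_square_iff[THEN iffD1])
  have "(\<Sum>s\<in>UNIV. (v s - v' s)\<^sup>2) + (\<Sum>s\<in>UNIV. \<Sum>a\<in>UNIV. (u s a - u' s a)\<^sup>2)
      \<le> (\<Sum>s\<in>(UNIV::'s set). e\<^sup>2) + (\<Sum>s\<in>(UNIV::'s set). \<Sum>a\<in>(UNIV::'b set). e\<^sup>2)"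
    by (intro add_mono sum_mono sq)
  also have "\<dots> = (real CARD('s) + real CARD('s) * real CARD('b)) * e\<^sup>2"
    by (simp add: algebra_simps)
  finally have "dist_vu v u v' u' \<le> sqrt ((real CARD('s) + real CARD('s) * real CARD('b)) * e\<^sup>2)"
    unfolding dist_vu_def by (rule real_sqrt_le_mono)
  then show ?thesis using e by (simp add: real_sqrt_mult)
qed

lemma has_vector_derivative_parts:
  assumes "(y has_vector_derivative pack f g) F"
  shows "((\<lambda>x. vpart (y x) s) has_real_derivative f s) F"
    and "((\<lambda>x. upart (y x) s a) has_real_derivative g s a) F"
proof -
  have "bounded_linear (\<lambda>z. vpart z s)" "bounded_linear (\<lambda>z. upart z s a)"
    by (intro bounded_linear_compose[OF bounded_linear_vec_nth] bounded_linear_vec_nth bounded_linear_fst bounded_linear_snd)+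
  from this[THEN bounded_linear.has_vector_derivative, OF assms]
  show "((\<lambda>x. vpart (y x) s) has_real_derivative f s) F"
    and "((\<lambda>x. upart (y x) s a) has_real_derivative g s a) F"
    by (auto simp: has_real_derivative_iff_has_vector_derivative)
qed

lemma lip_on_vpart: "lip_on X (\<lambda>z. vpart z s)"
  by (rule lip_onI[of _ _ 1])
    (simp, rule order_trans[OF dist_vec_nth_le dist_fst_le])

lemma lip_on_upart: "lip_on X (\<lambda>z. upart z s a)"
  by (rule lip_onI[of _ _ 1])
    (simp, rule order_trans[OF dist_vec_nth_le order_trans[OF dist_vec_nth_le dist_snd_le]])

lemma lip_on_bounded_derivative:
  fixes f f' :: "real \<Rightarrow> real"
  assumes "\<And>t. t \<ge> 0 \<Longrightarrow> (f has_real_derivative f' t) (at t within {0..})"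
    and "\<And>t. t \<ge> 0 \<Longrightarrow> \<bar>f' t\<bar> \<le> B"
  shows "lip_on {0..} f"
proof -
  have le: "\<bar>f t - f s\<bar> \<le> B * \<bar>t - s\<bar>" if st: "0 \<le> s" "s \<le> t" for s t
  proof -
    obtain x where x: "x \<in> {s..t}" "f t - f s = f' x * (t - s)"
      by (rule real_mvt_within[of s t "{0..}" f f']) (use assms(1) st in auto)
    then show ?thesis using assms(2)[of x] st by (auto simp: abs_mult intro!: mult_right_mono)
  qed
  show ?thesis
  proof (rule lip_onI)
    fix x y :: real assume "x \<in> {0..}" "y \<in> {0..}"
    then show "dist (f x) (f y) \<le> B * dist x y"
      using le[of x y] le[of y x] by (cases "x \<le> y") (auto simp: dist_real_def abs_minus_commute)
  qed
qed

context entropy_mdp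
begin

section \<open>Lipschitz continuity of the field on compact positive sets\<close>

context
  fixes X :: "((real ^ 's) \<times> (real ^ 'b ^ 's)) set"
  assumes X: "compact X" and pos: "\<And>z. z \<in> X \<Longrightarrow> posu (upart z)"
begin

lemma lip_on_usum: "lip_on X (\<lambda>z. usum (upart z) s)"
  unfolding usum_def by (intro lip_on_sum lip_on_upart)

lemma lip_on_pol: "lip_on X (\<lambda>z. pol (upart z) s a)"
  unfolding pol_def by (intro lip_on_divide X lip_on_upart lip_on_usum usum_pos pos)

lemma lip_on_ln_pol: "lip_on X (\<lambda>z. ln (pol (upart z) s a))"
  by (intro lip_on_ln X lip_on_pol pol_pos pos)

lemma lip_on_gvec: "lip_on X (\<lambda>z. gvec \<tau> \<gamma> P r (vpart z) (upart z) s a)"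
  unfolding gvec_def
  by (intro lip_on_diff lip_on_ln_pol lip_on_mult X lip_on_const lip_on_sum lip_on_vpart)

lemma lip_on_Fv: "lip_on X (\<lambda>z. Fv \<alpha> \<gamma> P (vpart z) (upart z) s)"
  unfolding Fv_def
  by (intro lip_on_minus lip_on_diff lip_on_mult X lip_on_const lip_on_sum lip_on_vpart lip_on_upart)

lemma lip_on_Fu: "lip_on X (\<lambda>z. Fu c \<tau> \<gamma> P r (vpart z) (upart z) s a)"
  unfolding Fu_def
  by (intro lip_on_minus lip_on_diff lip_on_mult X lip_on_const lip_on_sum lip_on_usum lip_on_pol lip_on_gvec)

lemma lip_on_diss: "lip_on X (\<lambda>z. diss (vpart z) (upart z))"
  unfolding diss_def power2_eq_square
  by (intro lip_on_add lip_on_diff lip_on_mult X lip_on_const lip_on_sum lip_on_vpart lip_on_upart lip_on_ln_pol)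

lemma lip_on_field:
  "lip_on X (\<lambda>z. pack (Fv \<alpha> \<gamma> P (vpart z) (upart z)) (Fu c \<tau> \<gamma> P r (vpart z) (upart z)))"
  unfolding pack_def by (intro lip_on_Pair lip_on_vec) (simp_all add: lip_on_Fv lip_on_Fu)

end

section \<open>Confinement and global existence\<close>

text \<open>\<open>lyap\<close> dominates a multiple of the squared deviation or divergence of each
  single coordinate, so a bound on it confines every coordinate to an open interval, a positive one
  for \<open>u\<close>. Convexity of \<open>X\<close> is for the nearest-point projection, the
  interior for excluding an exit.\<close>

lemma lyap_sublevel_box:
  "\<exists>X :: ((real ^ 's) \<times> (real ^ 'b ^ 's)) set. compact X \<and> convex X \<and> (\<forall>z\<in>X. posu (upart z)) \<and>
    (\<forall>z. posu (upart z) \<longrightarrow> lyap (vpart z) (upart z) \<le> B \<longrightarrow> z \<in> interior X)"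
proof -
  have "\<exists>lo hi. lo > 0 \<and> (\<forall>q>0. kld (us s a) q \<le> B / \<tau> \<longrightarrow> lo < q \<and> q < hi)" for s a
    using posu_us by (intro kld_sublevel_bounds) (simp add: posu_def)
  then obtain lo hi where lohi: "\<And>s a. lo s a > 0"
      "\<And>s a q. q > 0 \<Longrightarrow> kld (us s a) q \<le> B / \<tau> \<Longrightarrow> lo s a < q \<and> q < hi s a"
    by metis
  define R where "R = sqrt (2 * B / \<alpha>) + 1"
  define X where "X = cbox (pack (\<lambda>s. vs s - R) lo) (pack (\<lambda>s. vs s + R) hi)"
  have "z \<in> interior X" if z: "posu (upart z)" "lyap (vpart z) (upart z) \<le> B" for z
  proof -
    have "\<bar>vpart z s - vs s\<bar> < R" for s
    proof -
      have "\<alpha> / 2 * (vpart z s - vs s)\<^sup>2 \<le> B" using lyap_ge_v[OF z(1)] z(2) by (rule order_trans)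
      then have "\<bar>vpart z s - vs s\<bar>\<^sup>2 \<le> 2 * B / \<alpha>" using alpha by (simp add: field_simps)
      then have "\<bar>vpart z s - vs s\<bar> \<le> sqrt (2 * B / \<alpha>)" by (rule real_le_rsqrt)
      then show ?thesis by (simp add: R_def)
    qed
    then have v: "vs s - R < vpart z s" "vpart z s < vs s + R" for s
      by (auto simp: abs_less_iff algebra_simps)
    have "lo s a < upart z s a \<and> upart z s a < hi s a" for s a
    proof (rule lohi(2))
      show "upart z s a > 0" using z(1) by (simp add: posu_def)
      have "\<tau> * kld (us s a) (upart z s a) \<le> B" using lyap_ge_u[OF z(1)] z(2) by (rule order_trans)
      then show "kld (us s a) (upart z s a) \<le> B / \<tau>" using tau by (simp add: field_simps)
    qed
    with v show ?thesis
      unfolding X_def interior_cbox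
      by (cases z) (simp add: pack_def mem_box_Pair mem_box_vec)
  qed
  moreover have "posu (upart z)" if "z \<in> X" for z
    using that lohi(1) unfolding X_def posu_def
    by (cases z) (simp add: pack_def cbox_Pair_eq mem_cbox_vec, meson less_le_trans)
  ultimately show ?thesis
    by (intro exI[of _ X]) (auto simp: X_def)
qed

text \<open>Composed with the projection onto \<open>X\<close>, the field becomes globally Lipschitz
  and has a solution for all times. While this solution is in \<open>X\<close> it obeys the original
  system, so \<open>lyap\<close> does not increase, and hence it never leaves the interior.\<close>

lemma solution_exists:
  assumes u0: "posu u0"
  shows "\<exists>V U. is_solution \<alpha> c \<tau> \<gamma> P r V U \<and> V 0 = v0 \<and> U 0 = u0"
proof -
  define B where "B = lyap v0 u0"
  obtain X where box: "compact X" "convex X" "\<forall>z\<in>X. posu (upart z)"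
    "\<forall>z. posu (upart z) \<longrightarrow> lyap (vpart z) (upart z) \<le> B \<longrightarrow> z \<in> interior X"
    using lyap_sublevel_box[of B] by (elim exE conjE)
  note X = box[rule_format]
  have z0: "pack v0 u0 \<in> interior X"
    using X(4)[of "pack v0 u0"] u0 by (simp add: B_def)
  then have ne: "X \<noteq> {}" and cl: "closed X"
    using interior_subset X(1) by (auto intro: compact_imp_closed)
  define F where "F z = pack (Fv \<alpha> \<gamma> P (vpart z) (upart z)) (Fu c \<tau> \<gamma> P r (vpart z) (upart z))" for z
  have lip_proj: "lip_on UNIV (closest_point X)"
    by (rule lip_onI[of _ _ 1]) (use closest_point_lipschitz[OF X(2) cl ne] in simp)
  have "lip_on X F"
    unfolding F_def by (rule lip_on_field[OF X(1,3)])
  then have "lip_on UNIV (\<lambda>z. F (closest_point X z))"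
    using lip_proj
    by (rule lip_on_compose) (simp add: image_subset_iff closest_point_in_set[OF cl ne])
  then obtain L where L: "L-lipschitz_on UNIV (\<lambda>z. F (closest_point X z))"
    by (auto simp: lip_on_def)
  obtain y where y0: "y 0 = pack v0 u0" and
      y: "\<And>t. t \<ge> 0 \<Longrightarrow> (y has_vector_derivative F (closest_point X (y t))) (at t within {0..})"
    using lipschitz_ode_global_solution[OF L, of "pack v0 u0"] by blast
  have contin: "continuous_on {0..} y"
    unfolding continuous_on_eq_continuous_within
    using y has_vector_derivative_continuous by fastforce
  have yX: "(y has_vector_derivative F (y t)) (at t within {0..})" if "t \<ge> 0" "y t \<in> X" for t
    using y[OF that(1)] that(2) by (simp add: closest_point_self)
  have parts: "((\<lambda>x. vpart (y x) s) has_real_derivative Fv \<alpha> \<gamma> P (vpart (y t)) (upart (y t)) s) (at t within {0..})"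
      "((\<lambda>x. upart (y x) s a) has_real_derivative Fu c \<tau> \<gamma> P r (vpart (y t)) (upart (y t)) s a) (at t within {0..})"
    if "t \<ge> 0" "y t \<in> X" for s a t
    using has_vector_derivative_parts[OF yX[OF that, unfolded F_def]] by blast+
  have inside: "y t \<in> interior X" if "t \<ge> 0" for t
  proof (rule ccontr)
    assume out: "y t \<notin> interior X"
    \<comment> \<open>\<open>A\<close> collects the times outside the interior. It is closed, so its
      infimum \<open>t0\<close> belongs to it and is the first such time.\<close>
    define A where "A = {0..} \<inter> y -` (- interior X)"
    have "closed A" unfolding A_def
      by (rule continuous_closed_preimage[OF contin]) auto
    moreover have "t \<in> A" using out that by (simp add: A_def)
    moreover have bdd: "bdd_below A" by (auto simp: A_def intro!: bdd_belowI[of _ 0])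
    ultimately have "Inf A \<in> A" by (intro closed_contains_Inf) auto
    define t0 where "t0 = Inf A"
    have t0: "t0 \<ge> 0" "y t0 \<notin> interior X" using \<open>Inf A \<in> A\<close> by (auto simp: A_def t0_def)
    have before: "y s \<in> interior X" if "0 \<le> s" "s < t0" for s
      using cInf_lower[OF _ bdd, of s] that by (force simp: A_def t0_def)
    have "t0 \<noteq> 0" using t0 z0 y0 by metis
    then have t0': "t0 > 0" using t0 by simp
    have "y ` {0..<t0} \<subseteq> X"
      by (rule image_subsetI, rule subsetD[OF interior_subset before]) auto
    \<comment> \<open>Passing to the closure puts \<open>y t0\<close> itself in \<open>X\<close>, so
      the original field governs the motion up to and including \<open>t0\<close>.\<close>
    then have "y ` closure {0..<t0} \<subseteq> X"
      using t0' cl by (intro image_closure_subset continuous_on_subset[OF contin]) auto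
    then have inX: "y s \<in> X" if "s \<in> {0..t0}" for s
      using that t0' by auto
    have "((\<lambda>x. lyap (vpart (y x)) (upart (y x))) has_real_derivative - diss (vpart (y s)) (upart (y s))) (at s within {0..})"
      if "s \<in> {0..t0}" for s
      using that inX[OF that] by (intro lyap_has_derivative parts X(3)) auto
    then obtain s where s: "s \<in> {0..t0}"
        "lyap (vpart (y t0)) (upart (y t0)) - lyap (vpart (y 0)) (upart (y 0)) = - diss (vpart (y s)) (upart (y s)) * (t0 - 0)"
      using real_mvt_within[of 0 t0 "{0..}" "\<lambda>x. lyap (vpart (y x)) (upart (y x))" "\<lambda>x. - diss (vpart (y x)) (upart (y x))"] t0
      by auto
    have "diss (vpart (y s)) (upart (y s)) * t0 \<ge> 0"
      using inX[OF s(1)] t0 by (intro mult_nonneg_nonneg diss_nonneg X(3))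
    \<comment> \<open>At \<open>t0\<close> the value of \<open>lyap\<close> is still at most the
      initial one, which places \<open>y t0\<close> in the interior, against the choice of
      \<open>t0\<close>.\<close>
    with s have "lyap (vpart (y t0)) (upart (y t0)) \<le> B" by (simp add: y0 B_def)
    then have "y t0 \<in> interior X" using inX[of t0] t0 by (intro X(3,4)) auto
    with t0 show False by simp
  qed
  then have inX: "y t \<in> X" if "t \<ge> 0" for t using that interior_subset by blast
  have "is_solution \<alpha> c \<tau> \<gamma> P r (\<lambda>t. vpart (y t)) (\<lambda>t. upart (y t))"
    unfolding is_solution_def using inX parts X(3) by blast
  then show ?thesis using y0
    by (intro exI[of _ "\<lambda>t. vpart (y t)"] exI[of _ "\<lambda>t. upart (y t)"]) simp
qed

section \<open>Lyapunov stability\<close>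

lemma isCont_lyap_saddle: "isCont (\<lambda>z. lyap (vpart z) (upart z)) (pack vs us)"
proof -
  have "us s a \<noteq> 0" "(\<Sum>a\<in>UNIV. us s a) \<noteq> 0" for s a
    using posu_us usum_pos[OF posu_us, of s] by (auto simp: posu_def usum_def dest: less_imp_neq[THEN not_sym])
  then show ?thesis
    unfolding lyap_def kld_def usum_def by (intro continuous_intros) auto
qed

text \<open>A small \<open>lyap\<close> forces closeness by the coordinate bounds; continuity at the
  saddle point makes it small initially, and it never increases along a solution.\<close>

lemma lyapunov_stable:
  assumes eps: "\<epsilon> > 0"
  shows "\<exists>\<delta>>0. \<forall>V U. is_solution \<alpha> c \<tau> \<gamma> P r V U \<and> dist_vu (V 0) (U 0) vs us < \<delta> \<longrightarrow>
           (\<forall>t\<ge>0. dist_vu (V t) (U t) vs us < \<epsilon>)"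
proof -
  define N where "N = sqrt (real CARD('s) + real CARD('s) * real CARD('b))"
  \<comment> \<open>\<open>N\<close> converts coordinatewise bounds into a Euclidean one; dividing
    by \<open>N + 1\<close> leaves room for a strict inequality.\<close>
  define e where "e = \<epsilon> / (N + 1)"
  have N: "N \<ge> 0" by (simp add: N_def)
  then have e: "e > 0" using eps by (simp add: e_def)
  have "N * e = \<epsilon> * (N / (N + 1))" by (simp add: e_def)
  also have "\<dots> < \<epsilon> * 1" using eps N by (intro mult_strict_left_mono) auto
  finally have Ne: "N * e < \<epsilon>" by simp
  have "\<forall>\<^sub>F \<eta> in at_right 0. \<forall>q>0. kld (us s a) q \<le> \<eta> \<longrightarrow> \<bar>q - us s a\<bar> < e" for s a
    using posu_us by (intro kld_small_imp_close e) (auto simp: posu_def)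
  then have "\<forall>\<^sub>F \<eta> in at_right 0. \<forall>s a. \<forall>q>0. kld (us s a) q \<le> \<eta> \<longrightarrow> \<bar>q - us s a\<bar> < e"
    by (intro eventually_all_finite)
  \<comment> \<open>This keeps the threshold \<open>\<tau> * \<eta>\<close> below
    \<open>\<alpha> / 2 * e\<^sup>2\<close>, so that it controls the value vector as well as the
    occupancies.\<close>
  moreover have "\<forall>\<^sub>F \<eta> in at_right 0. \<eta> < \<alpha> / 2 * e\<^sup>2 / \<tau>"
    using alpha tau e by (intro eventually_at_right_less order_tendstoD(2)[OF tendsto_ident_at]) auto
  ultimately have "\<forall>\<^sub>F \<eta> in at_right (0::real). \<eta> > 0 \<and> \<eta> < \<alpha> / 2 * e\<^sup>2 / \<tau> \<and>
      (\<forall>s a. \<forall>q>0. kld (us s a) q \<le> \<eta> \<longrightarrow> \<bar>q - us s a\<bar> < e)"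
    using eventually_at_right_less[of 0] by eventually_elim auto
  then obtain \<eta> where \<eta>: "\<eta> > 0" "\<eta> < \<alpha> / 2 * e\<^sup>2 / \<tau>"
      "\<And>s a q. q > 0 \<Longrightarrow> kld (us s a) q \<le> \<eta> \<Longrightarrow> \<bar>q - us s a\<bar> < e"
    using eventually_happens[of _ "at_right (0::real)"] trivial_limit_at_right_real by blast
  have close: "dist_vu v u vs us < \<epsilon>" if u: "posu u" and le: "lyap v u \<le> \<tau> * \<eta>" for v u
  proof -
    have "\<bar>v s - vs s\<bar> \<le> e" for s
    proof -
      have "\<alpha> / 2 * (v s - vs s)\<^sup>2 \<le> \<tau> * \<eta>" using lyap_ge_v[OF u] le by (rule order_trans)
      also have "\<dots> \<le> \<alpha> / 2 * e\<^sup>2" using \<eta>(2) tau by (simp add: field_simps)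
      finally have "(v s - vs s)\<^sup>2 \<le> e\<^sup>2" using alpha by simp
      then show ?thesis using e by (simp add: abs_le_square_iff[symmetric])
    qed
    moreover have "\<bar>u s a - us s a\<bar> \<le> e" for s a
    proof -
      have "\<tau> * kld (us s a) (u s a) \<le> \<tau> * \<eta>" using lyap_ge_u[OF u] le by (rule order_trans)
      then have "kld (us s a) (u s a) \<le> \<eta>" using tau by simp
      then show ?thesis using \<eta>(3)[of "u s a" s a] u by (simp add: posu_def)
    qed
    ultimately have "dist_vu v u vs us \<le> N * e" unfolding N_def by (rule dist_vu_le)
    with Ne show ?thesis by simp
  qed
  obtain \<delta> where \<delta>: "\<delta> > 0" "\<And>z. dist z (pack vs us) < \<delta> \<Longrightarrow> lyap (vpart z) (upart z) < \<tau> * \<eta>"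
    using isCont_lyap_saddle tau \<eta>(1) unfolding continuous_at_eps_delta
    by (auto simp: lyap_saddle dist_real_def abs_less_iff dest!: spec[of _ "\<tau> * \<eta>"])
  have "dist_vu (V t) (U t) vs us < \<epsilon>"
    if sol: "is_solution \<alpha> c \<tau> \<gamma> P r V U" and "dist_vu (V 0) (U 0) vs us < \<delta>" "t \<ge> 0" for V U t
  proof (rule close)
    show "posu (U t)" using sol that by (auto simp: is_solution_def)
    have "lyap (V 0) (U 0) < \<tau> * \<eta>" using \<delta>(2)[of "pack (V 0) (U 0)"] that by (simp add: dist_pack)
    then show "lyap (V t) (U t) \<le> \<tau> * \<eta>"
      using solution_lyap_nonincreasing[OF sol, of 0 t] that by simp
  qed
  with \<delta>(1) show ?thesis by blast
qed

text \<open>\<open>(I - \<gamma> P\<^sub>\<pi>)\<^sup>T\<close> is bounded below in the \<open>\<ell>\<^sup>1\<close> norm, because the transpose of a stochastic matrix is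
  an \<open>\<ell>\<^sup>1\<close> contraction.\<close>

lemma saddle_policy_coercive:
  "(1 - \<gamma>) * (\<Sum>s\<in>UNIV. \<bar>d s\<bar>) \<le> (\<Sum>s'\<in>UNIV. \<bar>\<Sum>s\<in>UNIV. \<Sum>a\<in>UNIV. K a s s' * (pol us s a * d s)\<bar>)"
proof -
  define Q where "Q s' = (\<Sum>s\<in>UNIV. \<Sum>a\<in>UNIV. P a s s' * (pol us s a * \<bar>d s\<bar>))" for s'
  have "\<bar>d s'\<bar> \<le> \<bar>\<Sum>s\<in>UNIV. \<Sum>a\<in>UNIV. K a s s' * (pol us s a * d s)\<bar> + \<gamma> * Q s'" for s'
  proof -
    define p where "p = (\<Sum>s\<in>UNIV. \<Sum>a\<in>UNIV. P a s s' * (pol us s a * d s))"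
    have "(\<Sum>s\<in>UNIV. \<Sum>a\<in>UNIV. K a s s' * (pol us s a * d s))
        = (\<Sum>s\<in>UNIV. \<Sum>a\<in>UNIV. if s = s' then pol us s a * d s else 0) - \<gamma> * p"
      unfolding p_def sum_distrib_left sum_subtractf[symmetric]
      by (intro sum.cong refl) (simp add: Kmat_def left_diff_distrib)
    also have "(\<Sum>s\<in>UNIV. \<Sum>a\<in>UNIV. if s = s' then pol us s a * d s else 0)
        = (\<Sum>s\<in>UNIV. if s = s' then \<Sum>a\<in>UNIV. pol us s a * d s else 0)"
      by (intro sum.cong refl) simp
    also have "\<dots> = d s'"
      by (simp add: sum_pol[OF posu_us] flip: sum_distrib_right)
    finally have "d s' = (\<Sum>s\<in>UNIV. \<Sum>a\<in>UNIV. K a s s' * (pol us s a * d s)) + \<gamma> * p" by simp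
    then have "\<bar>d s'\<bar> \<le> \<bar>\<Sum>s\<in>UNIV. \<Sum>a\<in>UNIV. K a s s' * (pol us s a * d s)\<bar> + \<gamma> * \<bar>p\<bar>"
      using gamma(1) abs_triangle_ineq[of _ "\<gamma> * p"] by (simp add: abs_mult)
    moreover have "\<bar>p\<bar> \<le> Q s'"
    proof -
      have "\<bar>p\<bar> \<le> (\<Sum>s\<in>UNIV. \<Sum>a\<in>UNIV. \<bar>P a s s' * (pol us s a * d s)\<bar>)"
        unfolding p_def by (rule order_trans[OF sum_abs]) (intro sum_mono sum_abs)
      also have "\<dots> = Q s'"
        using P_nonneg pol_pos[OF posu_us] by (simp add: Q_def abs_mult abs_of_nonneg less_imp_le)
      finally show ?thesis .
    qed
    ultimately show ?thesis using gamma(1) mult_left_mono[of "\<bar>p\<bar>" "Q s'" \<gamma>] by linarith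
  qed
  then have "(\<Sum>s'\<in>UNIV. \<bar>d s'\<bar>) \<le>
      (\<Sum>s'\<in>UNIV. \<bar>\<Sum>s\<in>UNIV. \<Sum>a\<in>UNIV. K a s s' * (pol us s a * d s)\<bar> + \<gamma> * Q s')"
    by (rule sum_mono)
  \<comment> \<open>Summing over the target state first uses the row sums 1 of \<open>P\<close>: the
    transposed kernel preserves total mass.\<close>
  moreover have "(\<Sum>s'\<in>UNIV. Q s') = (\<Sum>s\<in>UNIV. \<bar>d s\<bar>)"
  proof -
    have "(\<Sum>s'\<in>UNIV. Q s') = (\<Sum>s\<in>UNIV. \<Sum>a\<in>UNIV. (\<Sum>s'\<in>UNIV. P a s s') * (pol us s a * \<bar>d s\<bar>))"
      unfolding Q_def by (subst sum_rotate3) (simp add: sum_distrib_right)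
    also have "\<dots> = (\<Sum>s\<in>UNIV. \<bar>d s\<bar>)"
      by (simp add: P_stoch sum_pol[OF posu_us] flip: sum_distrib_right)
    finally show ?thesis .
  qed
  ultimately show ?thesis
    by (simp add: sum.distrib algebra_simps flip: sum_distrib_left)
qed

section \<open>Global attractivity\<close>

lemma globally_attractive:
  assumes sol: "is_solution \<alpha> c \<tau> \<gamma> P r V U"
  shows "((\<lambda>t. V t s) \<longlongrightarrow> vs s) at_top" and "((\<lambda>t. U t s a) \<longlongrightarrow> us s a) at_top"
proof -
  have U_pos: "posu (U t)" if "t \<ge> 0" for t using sol that by (auto simp: is_solution_def)
  have evpos: "\<forall>\<^sub>F t in at_top. posu (U t)"
    using eventually_ge_at_top[of 0] by eventually_elim (rule U_pos)
  have V': "((\<lambda>x. V x s) has_real_derivative Fv \<alpha> \<gamma> P (V t) (U t) s) (at t within {0..})" if "t \<ge> 0" for s t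
    using sol that by (auto simp: is_solution_def)
  have U': "((\<lambda>x. U x s a) has_real_derivative Fu c \<tau> \<gamma> P r (V t) (U t) s a) (at t within {0..})" if "t \<ge> 0" for s a t
    using sol that by (auto simp: is_solution_def)
  obtain X where X: "compact X" and "convex X" and box: "\<forall>z\<in>X. posu (upart z)"
    "\<forall>z. posu (upart z) \<longrightarrow> lyap (vpart z) (upart z) \<le> lyap (V 0) (U 0) \<longrightarrow> z \<in> interior X"
    using lyap_sublevel_box[of "lyap (V 0) (U 0)"] by (elim exE conjE)
  note X' = box[rule_format]
  define y where "y t = pack (V t) (U t)" for t
  have y_parts: "vpart (y t) = V t" "upart (y t) = U t" for t by (simp_all add: y_def)
  have yX: "y t \<in> X" if "t \<ge> 0" for t
  proof -
    have "y t \<in> interior X"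
      using solution_lyap_nonincreasing[OF sol, of 0 t] that U_pos by (intro X'(2)) (auto simp: y_def)
    then show ?thesis using interior_subset by blast
  qed
  have bounded: "\<exists>B. \<forall>t\<ge>0. \<bar>f (y t)\<bar> \<le> B" if "lip_on X f" for f :: "_ \<Rightarrow> real"
  proof -
    have "bounded (f ` X)"
      using that X by (intro compact_imp_bounded compact_continuous_image lip_on_imp_continuous_on)
    then show ?thesis using yX by (auto simp: bounded_iff)
  qed
  have lipV: "lip_on {0..} (\<lambda>t. V t s)" for s
  proof -
    obtain B where "\<forall>t\<ge>0. \<bar>Fv \<alpha> \<gamma> P (V t) (U t) s\<bar> \<le> B"
      using bounded[OF lip_on_Fv[OF X X'(1), of s]] unfolding y_parts by blast
    then show ?thesis using V' by (intro lip_on_bounded_derivative) auto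
  qed
  have lipU: "lip_on {0..} (\<lambda>t. U t s a)" for s a
  proof -
    obtain B where "\<forall>t\<ge>0. \<bar>Fu c \<tau> \<gamma> P r (V t) (U t) s a\<bar> \<le> B"
      using bounded[OF lip_on_Fu[OF X X'(1), of s a]] unfolding y_parts by blast
    then show ?thesis using U' by (intro lip_on_bounded_derivative) auto
  qed
  \<comment> \<open>The field is bounded on \<open>X\<close>, so the trajectory is Lipschitz in
    time, and with it every Lipschitz function on \<open>X\<close> evaluated along it. This is the
    regularity that Barbalat's lemma asks for.\<close>
  have lipy: "lip_on {0..} y"
    unfolding y_def pack_def by (intro lip_on_Pair lip_on_vec) (simp_all add: lipV lipU)
  have yim: "y ` {0..} \<subseteq> X" using yX by auto
  have "lip_on {0..} (\<lambda>t. diss (V t) (U t))"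
    using lip_on_compose[OF lip_on_diss[OF X X'(1)] lipy yim] by (simp add: y_def)
  then have "lip_on {0..} (\<lambda>t. - diss (V t) (U t))" by (rule lip_on_minus)
  then obtain L where L: "L-lipschitz_on {0..} (\<lambda>t. - diss (V t) (U t))" by (auto simp: lip_on_def)
  obtain l where "((\<lambda>t. lyap (V t) (U t)) \<longlongrightarrow> l) at_top"
    using nonincreasing_bounded_below_tendsto[of "\<lambda>t. lyap (V t) (U t)" 0]
      solution_lyap_nonincreasing[OF sol] lyap_nonneg[OF U_pos] by blast
  then have "((\<lambda>t. - diss (V t) (U t)) \<longlongrightarrow> 0) at_top"
    using lyap_has_derivative[OF U_pos V' U'] L by (intro barbalat_lipschitz)
  then have diss0: "((\<lambda>t. diss (V t) (U t)) \<longlongrightarrow> 0) at_top"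
    using tendsto_minus_cancel_left[of "\<lambda>t. diss (V t) (U t)" 0 at_top] by simp
  have Vlim: "((\<lambda>t. V t s) \<longlongrightarrow> vs s) at_top" for s
  proof -
    have "((\<lambda>t. (V t s - vs s)\<^sup>2) \<longlongrightarrow> 0) at_top"
    proof (rule tendsto_0_le[OF diss0])
      show "\<forall>\<^sub>F t in at_top. norm ((V t s - vs s)\<^sup>2) \<le> norm (diss (V t) (U t)) * (1 / \<alpha>)"
        using evpos
      proof eventually_elim
        case (elim t)
        then show ?case using diss_ge_v[OF elim, of "V t" s] diss_nonneg[OF elim, of "V t"] alpha
          by (simp add: field_simps)
      qed
    qed
    then have "((\<lambda>t. sqrt ((V t s - vs s)\<^sup>2)) \<longlongrightarrow> sqrt 0) at_top" by (rule tendsto_real_sqrt)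
    then have "((\<lambda>t. V t s - vs s) \<longlongrightarrow> 0) at_top" by (simp add: tendsto_rabs_zero_iff)
    then show ?thesis by (simp add: LIM_zero_iff)
  qed
  show "((\<lambda>t. V t s) \<longlongrightarrow> vs s) at_top" by (rule Vlim)
  have pol_lim: "((\<lambda>t. pol (U t) s a) \<longlongrightarrow> pol us s a) at_top" for s a
  proof (rule kld_tendsto_0_imp_tendsto)
    show "pol us s a > 0" by (rule pol_pos[OF posu_us])
    show "\<forall>\<^sub>F t in at_top. pol (U t) s a > 0" using evpos by eventually_elim (rule pol_pos)
    show "((\<lambda>t. kld (pol us s a) (pol (U t) s a)) \<longlongrightarrow> 0) at_top"
    proof (rule tendsto_0_le[OF diss0])
      show "\<forall>\<^sub>F t in at_top. norm (kld (pol us s a) (pol (U t) s a)) \<le> norm (diss (V t) (U t)) * (1 / (\<tau> * usum us s))"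
        using evpos
      proof eventually_elim
        case (elim t)
        then show ?case
          using diss_ge_u[OF elim, of s a "V t"] diss_nonneg[OF elim, of "V t"] tau usum_pos[OF posu_us, of s]
            kld_nonneg[OF pol_pos[OF posu_us] pol_pos[OF elim], of s a]
          by (simp add: field_simps)
      qed
    qed
  qed
  \<comment> \<open>The second use of Barbalat's lemma, with the component of \<open>V\<close> as
    the convergent function.\<close>
  have Fv0: "((\<lambda>t. Fv \<alpha> \<gamma> P (V t) (U t) s) \<longlongrightarrow> 0) at_top" for s
  proof -
    have "lip_on {0..} (\<lambda>t. Fv \<alpha> \<gamma> P (V t) (U t) s)"
      using lip_on_compose[OF lip_on_Fv[OF X X'(1)] lipy yim] by (simp add: y_def)
    then obtain L where "L-lipschitz_on {0..} (\<lambda>t. Fv \<alpha> \<gamma> P (V t) (U t) s)" by (auto simp: lip_on_def)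
    then show ?thesis using V' Vlim by (intro barbalat_lipschitz)
  qed
  \<comment> \<open>\<open>U t - us\<close> splits into \<open>w\<close>, the policy error at the
    current mass, and the saddle policy times the mass error \<open>d\<close>. The first vanishes
    because masses stay bounded; the second is reached through the \<open>v\<close>
    equation.\<close>
  define d where "d t s = usum (U t) s - usum us s" for t s
  define w where "w t s a = (pol (U t) s a - pol us s a) * usum (U t) s" for t s a
  have w0: "((\<lambda>t. w t s a) \<longlongrightarrow> 0) at_top" for s a
  proof -
    obtain B where B: "\<And>t. t \<ge> 0 \<Longrightarrow> \<bar>usum (U t) s\<bar> \<le> B"
      using bounded[OF lip_on_usum[OF X X'(1), of s]] by (auto simp: y_def)
    have "((\<lambda>t. pol (U t) s a - pol us s a) \<longlongrightarrow> 0) at_top"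
      using pol_lim by (simp add: LIM_zero_iff)
    then show ?thesis
    proof (rule tendsto_0_le)
      show "\<forall>\<^sub>F t in at_top. norm (w t s a) \<le> norm (pol (U t) s a - pol us s a) * B"
        using eventually_ge_at_top[of 0]
        by eventually_elim (auto simp: w_def abs_mult intro!: mult_left_mono B)
    qed
  qed
  have e0: "((\<lambda>t. \<Sum>s\<in>UNIV. \<Sum>a\<in>UNIV. K a s s' * (pol us s a * d t s)) \<longlongrightarrow> 0) at_top" for s'
  proof -
    have "((\<lambda>t. \<alpha> * Fv \<alpha> \<gamma> P (V t) (U t) s' + \<alpha> * (V t s' - vs s')
          - (\<Sum>s\<in>UNIV. \<Sum>a\<in>UNIV. K a s s' * w t s a))
        \<longlongrightarrow> \<alpha> * 0 + \<alpha> * (vs s' - vs s') - (\<Sum>s\<in>UNIV. \<Sum>a\<in>UNIV. K a s s' * 0)) at_top"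
      by (intro tendsto_intros Fv0 Vlim w0)
    moreover have "\<forall>\<^sub>F t in at_top. \<alpha> * Fv \<alpha> \<gamma> P (V t) (U t) s' + \<alpha> * (V t s' - vs s')
          - (\<Sum>s\<in>UNIV. \<Sum>a\<in>UNIV. K a s s' * w t s a)
        = (\<Sum>s\<in>UNIV. \<Sum>a\<in>UNIV. K a s s' * (pol us s a * d t s))"
      using evpos
    proof eventually_elim
      case (elim t)
      have "U t s a - us s a - w t s a = pol us s a * d t s" for s a
        using usum_times_pol[OF elim, of s a] usum_times_pol[OF posu_us, of s a]
        by (simp add: w_def d_def algebra_simps)
      then have "(\<Sum>s\<in>UNIV. \<Sum>a\<in>UNIV. K a s s' * (pol us s a * d t s))
          = (\<Sum>s\<in>UNIV. \<Sum>a\<in>UNIV. K a s s' * (U t s a - us s a) - K a s s' * w t s a)"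
        by (simp flip: right_diff_distrib)
      then show ?case unfolding alpha_Fv by (simp add: sum_subtractf)
    qed
    ultimately show ?thesis by (simp add: tendsto_cong)
  qed
  \<comment> \<open>The images of the mass errors under the transposed matrix vanish by
    \<open>e0\<close>; coercivity recovers the mass errors themselves.\<close>
  have usum_lim: "((\<lambda>t. usum (U t) s) \<longlongrightarrow> usum us s) at_top" for s
  proof -
    have "((\<lambda>t. \<Sum>s'\<in>UNIV. \<bar>\<Sum>s\<in>UNIV. \<Sum>a\<in>UNIV. K a s s' * (pol us s a * d t s)\<bar>) \<longlongrightarrow> (\<Sum>s'\<in>(UNIV::'s set). \<bar>0\<bar>)) at_top"
      by (intro tendsto_sum tendsto_rabs e0)
    then have "((\<lambda>t. \<Sum>s'\<in>UNIV. \<bar>\<Sum>s\<in>UNIV. \<Sum>a\<in>UNIV. K a s s' * (pol us s a * d t s)\<bar>) \<longlongrightarrow> 0) at_top"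
      by simp
    then have "((\<lambda>t. d t s) \<longlongrightarrow> 0) at_top"
    proof (rule tendsto_0_le)
      have "\<bar>d t s\<bar> \<le> (\<Sum>s'\<in>UNIV. \<bar>\<Sum>s\<in>UNIV. \<Sum>a\<in>UNIV. K a s s' * (pol us s a * d t s)\<bar>) * (1 / (1 - \<gamma>))" for t
      proof -
        have "(1 - \<gamma>) * \<bar>d t s\<bar> \<le> (1 - \<gamma>) * (\<Sum>s\<in>UNIV. \<bar>d t s\<bar>)"
          using gamma(2) by (intro mult_left_mono member_le_sum) auto
        also note saddle_policy_coercive
        finally show ?thesis using gamma(2) by (simp add: field_simps)
      qed
      then show "\<forall>\<^sub>F t in at_top. norm (d t s) \<le>
          norm (\<Sum>s'\<in>UNIV. \<bar>\<Sum>s\<in>UNIV. \<Sum>a\<in>UNIV. K a s s' * (pol us s a * d t s)\<bar>) * (1 / (1 - \<gamma>))"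
        by (simp add: abs_of_nonneg sum_nonneg)
    qed
    then show ?thesis by (simp add: d_def LIM_zero_iff)
  qed
  have "((\<lambda>t. usum (U t) s * pol (U t) s a) \<longlongrightarrow> usum us s * pol us s a) at_top"
    by (intro tendsto_mult usum_lim pol_lim)
  moreover have "\<forall>\<^sub>F t in at_top. usum (U t) s * pol (U t) s a = U t s a"
    using evpos by eventually_elim (rule usum_times_pol)
  ultimately show "((\<lambda>t. U t s a) \<longlongrightarrow> us s a) at_top"
    by (simp add: tendsto_cong usum_times_pol[OF posu_us])
qed

end

theorem theorem3p3:
  fixes P :: "'b::finite \<Rightarrow> 's::finite \<Rightarrow> 's \<Rightarrow> real"
    and r :: "'s \<Rightarrow> 'b \<Rightarrow> real"
    and \<gamma> \<tau> \<alpha> c :: real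
    and vs :: "'s \<Rightarrow> real" and us :: "'s \<Rightarrow> 'b \<Rightarrow> real"
  assumes P_nonneg: "\<forall>a s s'. P a s s' \<ge> 0"
    and P_stoch: "\<forall>a s. (\<Sum>s'\<in>UNIV. P a s s') = 1"
    and r_nonneg: "\<forall>s a. r s a \<ge> 0"
    and gamma: "0 < \<gamma>" "\<gamma> < 1"
    and tau: "\<tau> > 0"
    and alpha: "\<alpha> > 0"
    and c: "0 < c" "c < 1"
    and saddle: "saddle_point \<alpha> \<tau> \<gamma> P r vs us"
  shows
    \<comment> \<open>forward completeness: from every initial condition a global solution exists\<close>
    "(\<forall>v0 u0. posu u0 \<longrightarrow>
        (\<exists>V U. is_solution \<alpha> c \<tau> \<gamma> P r V U \<and> V 0 = v0 \<and> U 0 = u0))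
     \<comment> \<open>Lyapunov stability of the saddle point\<close>
     \<and> (\<forall>\<epsilon>>0. \<exists>\<delta>>0. \<forall>V U. is_solution \<alpha> c \<tau> \<gamma> P r V U \<and>
           dist_vu (V 0) (U 0) vs us < \<delta> \<longrightarrow>
           (\<forall>t\<ge>0. dist_vu (V t) (U t) vs us < \<epsilon>))
     \<comment> \<open>global attractivity\<close>
     \<and> (\<forall>V U. is_solution \<alpha> c \<tau> \<gamma> P r V U \<longrightarrow>
           (\<forall>s. ((\<lambda>t. V t s) \<longlongrightarrow> vs s) at_top) \<and>
           (\<forall>s a. ((\<lambda>t. U t s a) \<longlongrightarrow> us s a) at_top))"
proof -
  interpret entropy_mdp P r \<gamma> \<tau> \<alpha> c vs us
    using assms by unfold_locales auto
  show ?thesis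
    using solution_exists lyapunov_stable globally_attractive by auto
qed

end
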